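(* Let $K$ be a convex body in $\mathbb{R}^n$ containing a ball of radius $1$, let $z_K$ be the centroid of $K$, and let $R\ge 0$ be defined by $R^2=\mathbb{E}_{K}\left(\|x-z_K\|_2^2\right)$, where $\mathbb{E}_K$ denotes expectation over $x$ uniformly distributed on $K$. Let $S_1,S_2\subseteq K$ be two measurable subsets of $K$ such that $S_1$ and $S_2$ are axis-disjoint. Then for any $\varepsilon\ge 0$, the set $S_3=K\setminus(S_1\cup S_2)$ satisfies $$\mathrm{vol}(S_3)\ge \frac{\varepsilon}{800\cdot n^{3.5}R}\cdot\left(\min\{\mathrm{vol}(S_1),\mathrm{vol}(S_2)\}-\varepsilon\cdot\mathrm{vol}(K)\right).$$
   Context: Two measurable sets $S_1,S_2\subseteq\mathbb{R}^n$ are called axis-disjoint if for all $x\in S_1$ and all $y\in S_2$, $|\{i\in\{1,\dots,n\}: x_i=y_i\}|\le n-2$. Here $\mathrm{vol}$ denotes $n$-dimensional Lebesgue measure. *)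

theory Defs
  imports "HOL-Probability.Probability"
begin

definition convex_body :: "'a::euclidean_space set \<Rightarrow> bool" where
  "convex_body K \<longleftrightarrow> convex K \<and> compact K \<and> interior K \<noteq> {}"

abbreviation vol :: "'a::euclidean_space set \<Rightarrow> real" where
  "vol A \<equiv> measure lebesgue A"

abbreviation uniform_expectation ::
    "'a::euclidean_space set \<Rightarrow> ('a \<Rightarrow> 'b::{banach, second_countable_topology}) \<Rightarrow> 'b" where
  "uniform_expectation K f \<equiv> integral\<^sup>L (uniform_measure lebesgue K) f"

definition centroid :: "'a::euclidean_space set \<Rightarrow> 'a" where
  "centroid K = uniform_expectation K (\<lambda>x. x)"

text \<open>The bound is taken in the integers: for dimension 1 it is negative, so that one of the
  two sets must then be empty.\<close>

definition axis_disjoint :: "(real ^ 'n) set \<Rightarrow> (real ^ 'n) set \<Rightarrow> bool" where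
  "axis_disjoint S1 S2 \<longleftrightarrow>
     (\<forall>x\<in>S1. \<forall>y\<in>S2. int (card {i. x $ i = y $ i}) \<le> int CARD('n) - 2)"

end

theory Submission
  imports Defs
begin

text \<open>Average the indicator of $S_1$ over axis-parallel cubes of side $\delta = \varepsilon / n^{3/2}$ centred in
  a slightly shrunken copy $L$ of $K$, giving a function $f$ that varies by at most $1/\delta$ per unit of
  $\ell_1$-distance. Inside one cube, exchange the coordinates of two independent uniform points one at a time:
  every position is uniform, and passing from $S_1$ to $S_2$ forces a visit to $S_3$. This shows that the local
  density of $S_3$ is at least $f (1 - f) / n$. The sets $f \ge 3/4$ and $f \le 1/4$ are separated, and almost
  as large as $S_1$ and $S_2$ unless $S_3$ is already big, so an isoperimetric inequality in $L$ bounds from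
  below the volume of the region in between, where $f (1 - f) \ge 3/16$.

  The isoperimetric inequality (Bobkov's argument) needs only Brunn--Minkowski: if $A$ and $B$ are far apart and
  $C$ is the part of $L$ in a ball, then $(1-t) A + t C$ and $(1-t) B + t C$ are disjoint subsets of $L$ for
  small $t$. By the exponential decay of tails (Borell's lemma), which also follows from Brunn--Minkowski, a
  radius of order $R \log (1 / \mathrm{vol}(A))$ leaves outside the ball only a small fraction of the volume of $A$.\<close>

section \<open>The Brunn--Minkowski inequality\<close>

text \<open>The logarithm in the radius does not reach the final bound. For the smaller fraction
  \<alpha>, disjointness allows only t of order d / (R ln (1/\<alpha>)), but Brunn--Minkowski gains
  \<alpha> powr (1 - t) - \<alpha>, about \<alpha> t ln (1/\<alpha>), and the two logarithms cancel.
  A tail of at most \<alpha> / 9 costs only order t \<alpha>, less than the gain.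

  The exponent 3.5 collects 3/2 from the cube side, 1 from comparing the sum norm with the Euclidean
  norm, and 1 from the coordinate exchanges. In the cube side, sqrt n makes a cube fit into the
  Euclidean margin left by shrinking, and n appears because two shrinkings by \<epsilon> / (2 n)
  lose at most the fraction \<epsilon> of the volume, which is the loss that the statement allows.

  The constant 800 rounds up 750 = 3 * 25 * 10: separation \<epsilon> / (3 n^2.5), isoperimetric
  constant 25, and 10 from collecting the terms in the volume of the remaining set. The unit ball
  serves twice: it turns shrinking into a Euclidean margin, and in dimension at least 2 it forces R
  \<ge> 1/2, so that the separation is below R.\<close>

lemma negligible_coordinate_plane: "i \<in> Basis \<Longrightarrow> negligible {x::'a::euclidean_space. x \<bullet> i = c}"
  using negligible_standard_hyperplane by blast

lemma compact_outside_ball: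
  fixes K :: "'a::euclidean_space set"
  assumes "compact K"
  shows "compact {x \<in> K. s \<le> norm (x - z)}"
proof -
  have "{x \<in> K. s \<le> norm (x - z)} = K \<inter> {x. s \<le> norm (x - z)}" by auto
  moreover have "closed {x. s \<le> norm (x - z)}" by (intro closed_Collect_le continuous_intros)
  ultimately show ?thesis using compact_Int_closed[OF assms] by simp
qed

section \<open>Weighted Minkowski sums\<close>

definition conv_sum :: "real \<Rightarrow> 'a::euclidean_space set \<Rightarrow> 'a set \<Rightarrow> 'a set" where
  "conv_sum t A B = (\<lambda>(x, y). (1 - t) *\<^sub>R x + t *\<^sub>R y) ` (A \<times> B)"

lemma conv_sumI: "x \<in> A \<Longrightarrow> y \<in> B \<Longrightarrow> z = (1 - t) *\<^sub>R x + t *\<^sub>R y \<Longrightarrow> z \<in> conv_sum t A B"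
  unfolding conv_sum_def by auto

lemma conv_sumE:
  assumes "z \<in> conv_sum t A B"
  obtains x y where "x \<in> A" "y \<in> B" "z = (1 - t) *\<^sub>R x + t *\<^sub>R y"
  using assms unfolding conv_sum_def by auto

lemma conv_sum_mono: "A \<subseteq> A' \<Longrightarrow> B \<subseteq> B' \<Longrightarrow> conv_sum t A B \<subseteq> conv_sum t A' B'"
  unfolding conv_sum_def by auto

lemma conv_sum_commute: "conv_sum t A B = conv_sum (1 - t) B A"
  by (auto elim!: conv_sumE intro!: conv_sumI)

lemma conv_sum_subset_convex:
  assumes "convex L" "A \<subseteq> L" "B \<subseteq> L" "0 \<le> t" "t \<le> 1"
  shows "conv_sum t A B \<subseteq> L"
  using assms by (auto simp: conv_sum_def subset_iff intro!: convexD)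

text \<open>Minkowski sums of measurable sets can fail to be measurable; working with compact sets
  avoids the question.\<close>

lemma compact_conv_sum:
  assumes "compact A" "compact B"
  shows "compact (conv_sum t A B)"
proof -
  have "continuous_on (A \<times> B) (\<lambda>(x, y). (1 - t) *\<^sub>R x + t *\<^sub>R y)"
    unfolding case_prod_unfold by (intro continuous_intros)
  then show ?thesis
    unfolding conv_sum_def by (rule compact_continuous_image) (rule compact_Times[OF assms])
qed

text \<open>Homogeneity of the weighted geometric mean. It lets the estimates for parts of fraction
  p and 1 - p add up to the estimate for the whole, and later factors out the volume of the
  body.\<close>

lemma powr_weighted_split:
  fixes a b p t :: real
  assumes "0 \<le> p" "0 \<le> a" "0 \<le> b"
  shows "(p * a) powr (1 - t) * (p * b) powr t = p * (a powr (1 - t) * b powr t)"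
proof (cases "p = 0")
  case False
  then have "p powr (1 - t) * p powr t = p"
    using assms by (simp flip: powr_add)
  then show ?thesis
    using assms by (simp add: powr_mult mult.assoc mult.left_commute[of "a powr (1 - t)"] flip: mult.assoc[of "p powr (1 - t)"])
qed simp

text \<open>The box whose corners are the weighted means of the corners lies in the sum. Its sides
  are weighted arithmetic means of the given sides, so the inequality between arithmetic and
  geometric means, applied in each coordinate, suffices.\<close>

lemma brunn_minkowski_box:
  fixes a b c d :: "'a::euclidean_space"
  assumes t: "0 < t" "t < 1"
    and ab: "\<And>i. i \<in> Basis \<Longrightarrow> a \<bullet> i < b \<bullet> i" and cd: "\<And>i. i \<in> Basis \<Longrightarrow> c \<bullet> i < d \<bullet> i"
  shows "vol (cbox a b) powr (1 - t) * vol (cbox c d) powr t \<le> vol (conv_sum t (cbox a b) (cbox c d))"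
proof -
  define l u where "l = (1 - t) *\<^sub>R a + t *\<^sub>R c" and "u = (1 - t) *\<^sub>R b + t *\<^sub>R d"
  have lu: "u \<bullet> i - l \<bullet> i = (1 - t) * (b \<bullet> i - a \<bullet> i) + t * (d \<bullet> i - c \<bullet> i)" for i
    by (simp add: l_def u_def algebra_simps)
  have lu_pos: "u \<bullet> i - l \<bullet> i > 0" if "i \<in> Basis" for i
    unfolding lu using ab[OF that] cd[OF that] t by (intro add_pos_pos mult_pos_pos) auto
  have sub: "cbox l u \<subseteq> conv_sum t (cbox a b) (cbox c d)"
  proof
    fix z assume z: "z \<in> cbox l u"
    \<comment> \<open>The relative position of \<open>z\<close> along side i. The points at the same
      relative position in the two given boxes combine to \<open>z\<close>.\<close>
    define p where "p i = (z \<bullet> i - l \<bullet> i) / (u \<bullet> i - l \<bullet> i)" for i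
    have p: "0 \<le> p i" "p i \<le> 1" "z \<bullet> i = l \<bullet> i + p i * (u \<bullet> i - l \<bullet> i)" if "i \<in> Basis" for i
      using z lu_pos[OF that] that by (auto simp: p_def mem_box divide_simps)
    define x where "x = (\<Sum>i\<in>Basis. (a \<bullet> i + p i * (b \<bullet> i - a \<bullet> i)) *\<^sub>R i)"
    define y where "y = (\<Sum>i\<in>Basis. (c \<bullet> i + p i * (d \<bullet> i - c \<bullet> i)) *\<^sub>R i)"
    have in_seg: "r \<le> r + q * (s - r) \<and> r + q * (s - r) \<le> s" if "0 \<le> q" "q \<le> 1" "r < s" for q r s :: real
      using that mult_left_le_one_le[of "s - r" q] mult_nonneg_nonneg[of q "s - r"] by linarith
    have "x \<in> cbox a b" "y \<in> cbox c d"
      using in_seg p(1,2) ab cd by (auto simp: mem_box x_def y_def less_imp_le)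
    moreover have "z = (1 - t) *\<^sub>R x + t *\<^sub>R y"
    proof (rule euclidean_eqI)
      fix i :: 'a assume i: "i \<in> Basis"
      have "x \<bullet> i = a \<bullet> i + p i * (b \<bullet> i - a \<bullet> i)" "y \<bullet> i = c \<bullet> i + p i * (d \<bullet> i - c \<bullet> i)"
        using i by (simp_all add: x_def y_def)
      then show "z \<bullet> i = ((1 - t) *\<^sub>R x + t *\<^sub>R y) \<bullet> i"
        unfolding p(3)[OF i, unfolded lu] inner_add_left inner_scaleR_left l_def by (simp only:) (simp add: algebra_simps)
    qed
    ultimately show "z \<in> conv_sum t (cbox a b) (cbox c d)" by (rule conv_sumI)
  qed
  have ne: "cbox a b \<noteq> {}" "cbox c d \<noteq> {}" "cbox l u \<noteq> {}"
    using ab cd lu_pos by (auto simp: box_ne_empty less_imp_le)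
  have "vol (cbox a b) powr (1 - t) * vol (cbox c d) powr t
      = (\<Prod>i\<in>Basis. (b \<bullet> i - a \<bullet> i) powr (1 - t) * (d \<bullet> i - c \<bullet> i) powr t)"
    using ne ab cd by (simp add: content_cbox' prod.distrib flip: prod_powr_distrib)
  also have "\<dots> \<le> (\<Prod>i\<in>Basis. u \<bullet> i - l \<bullet> i)"
    unfolding lu using ab cd t by (intro prod_mono conjI Youngs_inequality_0) (auto simp: less_imp_le)
  also have "\<dots> = vol (cbox l u)"
    using ne by (simp add: content_cbox')
  also have "\<dots> \<le> vol (conv_sum t (cbox a b) (cbox c d))"
    by (intro measure_mono_fmeasurable sub) (auto intro!: lmeasurable_compact compact_conv_sum)
  finally show ?thesis .
qed

section \<open>Finite unions of boxes, cut by coordinate hyperplanes\<close>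

definition box_family :: "'a::euclidean_space set set \<Rightarrow> bool" where
  "box_family \<D> \<longleftrightarrow> finite \<D> \<and> (\<forall>D\<in>\<D>. interior D \<noteq> {} \<and> (\<exists>a b. D = cbox a b))
     \<and> pairwise (\<lambda>D E. interior D \<inter> interior E = {}) \<D>"

lemma box_family_compact: "box_family \<D> \<Longrightarrow> compact (\<Union>\<D>)"
  unfolding box_family_def by (intro compact_Union) auto

text \<open>Flat pieces are dropped for two reasons: every member keeps positive volume, and the
  number of boxes falls as soon as one box lies entirely on the other side of the cut.\<close>

definition cut_family :: "'a::euclidean_space set \<Rightarrow> 'a set set \<Rightarrow> 'a set set" where
  "cut_family H \<D> = {E \<in> (\<lambda>D. D \<inter> H) ` \<D>. interior E \<noteq> {}}"

text \<open>\<open>H\<close> will be either closed half-space of a coordinate hyperplane; the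
  hypothesis on \<open>H\<close> says that a box cut by it is again a box.\<close>

lemma cut_family:
  fixes H :: "'a::euclidean_space set"
  assumes \<D>: "box_family \<D>" and H: "\<And>a b. \<exists>a' b'. cbox a b \<inter> H = cbox a' b'"
  shows "box_family (cut_family H \<D>)" "card (cut_family H \<D>) \<le> card \<D>"
    "\<Union>(cut_family H \<D>) \<subseteq> \<Union>\<D> \<inter> H" "vol (\<Union>(cut_family H \<D>)) = vol (\<Union>\<D> \<inter> H)"
    "D \<in> \<D> \<Longrightarrow> interior (D \<inter> H) = {} \<Longrightarrow> card (cut_family H \<D>) < card \<D>"
proof -
  have fin: "finite \<D>" using \<D> by (simp add: box_family_def)
  show sub: "\<Union>(cut_family H \<D>) \<subseteq> \<Union>\<D> \<inter> H" by (auto simp: cut_family_def)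
  have box: "\<exists>a b. D \<inter> H = cbox a b" if D: "D \<in> \<D>" for D
  proof -
    obtain a b where "D = cbox a b" using D \<D> unfolding box_family_def by meson
    then show ?thesis using H[of a b] by simp
  qed
  show bf: "box_family (cut_family H \<D>)"
    unfolding box_family_def
  proof (intro conjI ballI)
    show "finite (cut_family H \<D>)" using fin by (simp add: cut_family_def)
    fix D assume "D \<in> cut_family H \<D>"
    then show "interior D \<noteq> {}" "\<exists>a b. D = cbox a b" using box by (auto simp: cut_family_def)
  next
    show "pairwise (\<lambda>D E. interior D \<inter> interior E = {}) (cut_family H \<D>)"
    proof (rule pairwiseI)
      fix D E assume "D \<in> cut_family H \<D>" "E \<in> cut_family H \<D>" and ne: "D \<noteq> E"
      then have "D \<in> (\<lambda>D. D \<inter> H) ` \<D>" "E \<in> (\<lambda>D. D \<inter> H) ` \<D>" by (simp_all add: cut_family_def)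
      then obtain D' E' where DE: "D' \<in> \<D>" "E' \<in> \<D>" "D = D' \<inter> H" "E = E' \<inter> H" unfolding image_iff by blast
      then have "D' \<noteq> E'" using ne by auto
      then have "interior D' \<inter> interior E' = {}"
        using \<D> DE(1,2) unfolding box_family_def by (blast dest: pairwiseD)
      then show "interior D \<inter> interior E = {}"
        unfolding DE(3,4) interior_Int by blast
    qed
  qed
  show "card (cut_family H \<D>) \<le> card \<D>"
  proof -
    have "cut_family H \<D> \<subseteq> (\<lambda>D. D \<inter> H) ` \<D>" by (auto simp: cut_family_def)
    then have "card (cut_family H \<D>) \<le> card ((\<lambda>D. D \<inter> H) ` \<D>)"
      using fin by (intro card_mono) auto
    also have "\<dots> \<le> card \<D>" using fin by (rule card_image_le)
    finally show ?thesis .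
  qed
  show "card (cut_family H \<D>) < card \<D>" if D: "D \<in> \<D>" and em: "interior (D \<inter> H) = {}"
  proof -
    have "cut_family H \<D> \<subseteq> (\<lambda>D. D \<inter> H) ` (\<D> - {D})" using em by (auto simp: cut_family_def)
    then have "card (cut_family H \<D>) \<le> card ((\<lambda>D. D \<inter> H) ` (\<D> - {D}))"
      using fin by (intro card_mono) auto
    also have "\<dots> \<le> card (\<D> - {D})" using fin by (intro card_image_le) auto
    also have "\<dots> < card \<D>" using D fin by (intro psubset_card_mono) auto
    finally show ?thesis .
  qed
  \<comment> \<open>The dropped pieces are boxes with empty interior, so together they are
    negligible and the volume is unchanged.\<close>
  let ?N = "\<Union>{E \<in> (\<lambda>D. D \<inter> H) ` \<D>. interior E = {}}"
  have neg: "negligible ?N"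
  proof (rule negligible_Union)
    show "finite {E \<in> (\<lambda>D. D \<inter> H) ` \<D>. interior E = {}}" using fin by simp
    fix E assume "E \<in> {E \<in> (\<lambda>D. D \<inter> H) ` \<D>. interior E = {}}"
    then obtain D where "D \<in> \<D>" "E = D \<inter> H" and em: "interior E = {}" by blast
    then obtain a b where "E = cbox a b" using box[of D] by metis
    then show "negligible E" using em by (simp add: negligible_interval)
  qed
  have "\<Union>\<D> \<inter> H = \<Union>(cut_family H \<D>) \<union> ?N" unfolding cut_family_def by blast
  moreover have "vol (\<Union>(cut_family H \<D>) \<union> ?N) = vol (\<Union>(cut_family H \<D>))"
    using box_family_compact[OF bf] neg
    by (intro measure_Un_null_set) (auto simp: negligible_iff_null_sets dest: lmeasurable_compact)
  ultimately show "vol (\<Union>(cut_family H \<D>)) = vol (\<Union>\<D> \<inter> H)" by simp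
qed

lemma compact_halfspace_parts:
  fixes A :: "'a::euclidean_space set"
  assumes A: "compact A" and i: "i \<in> Basis"
  shows "vol (A \<inter> {x. x \<bullet> i \<le> c}) + vol (A \<inter> {x. x \<bullet> i \<ge> c}) = vol A"
proof -
  have c: "closed {x::'a. x \<bullet> i \<le> c}" "closed {x::'a. x \<bullet> i \<ge> c}"
    using closed_halfspace_le[of i c] closed_halfspace_ge[of c i] by (simp_all add: inner_commute)
  have m: "A \<inter> {x. x \<bullet> i \<le> c} \<in> lmeasurable" "A \<inter> {x. x \<bullet> i \<ge> c} \<in> lmeasurable"
    using c A by (auto intro!: lmeasurable_compact compact_Int_closed)
  have "(A \<inter> {x. x \<bullet> i \<le> c}) \<inter> (A \<inter> {x. x \<bullet> i \<ge> c}) \<subseteq> {x. x \<bullet> i = c}" by auto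
  then have "measure lebesgue ((A \<inter> {x. x \<bullet> i \<le> c}) \<inter> (A \<inter> {x. x \<bullet> i \<ge> c})) = 0"
    using negligible_coordinate_plane[OF i] by (meson negligible_imp_measure0 negligible_subset)
  then have "vol ((A \<inter> {x. x \<bullet> i \<le> c}) \<union> (A \<inter> {x. x \<bullet> i \<ge> c}))
      = vol (A \<inter> {x. x \<bullet> i \<le> c}) + vol (A \<inter> {x. x \<bullet> i \<ge> c})"
    using measure_Un3[OF m] by simp
  moreover have "(A \<inter> {x. x \<bullet> i \<le> c}) \<union> (A \<inter> {x. x \<bullet> i \<ge> c}) = A" by auto
  ultimately show ?thesis by simp
qed

text \<open>Intermediate values: the volume below the hyperplane at height c is Lipschitz in c,
  because the slab between two heights lies in a box whose other sides bound
  \<open>B\<close>.\<close>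

lemma halfspace_fraction:
  fixes B :: "'a::euclidean_space set"
  assumes B: "compact B" and i: "i \<in> Basis" and p: "0 \<le> p" "p \<le> 1"
  obtains c where "vol (B \<inter> {x. x \<bullet> i \<le> c}) = p * vol B"
proof -
  obtain u where u: "B \<subseteq> cbox (-u) u"
    using B bounded_subset_cbox_symmetric compact_imp_bounded by blast
  define g where "g c = vol (B \<inter> {x. x \<bullet> i \<le> c})" for c
  have cl: "closed {x::'a. x \<bullet> i \<le> c}" for c
    using closed_halfspace_le[of i c] by (simp add: inner_commute)
  have m: "B \<inter> {x. x \<bullet> i \<le> c} \<in> lmeasurable" for c
    using cl B by (auto intro!: lmeasurable_compact compact_Int_closed)
  define P where "P = (\<Prod>j\<in>Basis - {i}. 2 * \<bar>u \<bullet> j\<bar>)"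
  have P0: "P \<ge> 0" by (auto simp: P_def intro!: prod_nonneg)
  have lip: "0 \<le> g c' - g c \<and> g c' - g c \<le> P * (c' - c)" if "c \<le> c'" for c c'
  proof -
    define l where "l = (\<Sum>j\<in>Basis. (if j = i then c else - \<bar>u \<bullet> j\<bar>) *\<^sub>R j)"
    define v where "v = (\<Sum>j\<in>Basis. (if j = i then c' else \<bar>u \<bullet> j\<bar>) *\<^sub>R j)"
    have mono: "g c \<le> g c'" unfolding g_def using that by (intro measure_mono_fmeasurable m) (auto simp: fmeasurableD m)
    have "B \<inter> {x. x \<bullet> i \<le> c'} \<subseteq> (B \<inter> {x. x \<bullet> i \<le> c}) \<union> cbox l v"
    proof
      fix x assume x: "x \<in> B \<inter> {x. x \<bullet> i \<le> c'}"
      have "- \<bar>u \<bullet> j\<bar> \<le> x \<bullet> j \<and> x \<bullet> j \<le> \<bar>u \<bullet> j\<bar>" if "j \<in> Basis" for j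
        using u x that by (fastforce simp: mem_box)
      then show "x \<in> (B \<inter> {x. x \<bullet> i \<le> c}) \<union> cbox l v"
        using x by (auto simp: mem_box l_def v_def)
    qed
    then have "g c' \<le> vol ((B \<inter> {x. x \<bullet> i \<le> c}) \<union> cbox l v)"
      unfolding g_def by (intro measure_mono_fmeasurable) (auto simp: m fmeasurableD)
    also have "\<dots> \<le> g c + vol (cbox l v)"
      unfolding g_def by (intro measure_Un_le) (auto simp: m fmeasurableD)
    also have "vol (cbox l v) = P * (c' - c)"
    proof -
      have "cbox l v \<noteq> {}" using that by (auto simp: box_ne_empty l_def v_def)
      then have "vol (cbox l v) = (\<Prod>j\<in>Basis. v \<bullet> j - l \<bullet> j)" by (simp add: content_cbox')
      also have "\<dots> = (v \<bullet> i - l \<bullet> i) * (\<Prod>j\<in>Basis - {i}. v \<bullet> j - l \<bullet> j)"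
        using i by (simp add: prod.remove)
      also have "(\<Prod>j\<in>Basis - {i}. v \<bullet> j - l \<bullet> j) = P"
        unfolding P_def by (intro prod.cong) (auto simp: l_def v_def)
      finally show ?thesis using i by (simp add: l_def v_def)
    qed
    finally show ?thesis using mono by simp
  qed
  have "P-lipschitz_on UNIV g"
  proof (rule lipschitz_onI[OF _ P0])
    fix x y
    show "dist (g x) (g y) \<le> P * dist x y"
      using lip[of x y] lip[of y x] by (cases "x \<le> y") (auto simp: dist_real_def)
  qed
  then have cont: "continuous_on S g" for S
    by (meson lipschitz_on_continuous_on continuous_on_subset subset_UNIV)
  \<comment> \<open>The extra - 1 puts \<open>B\<close> strictly above height \<open>a\<close>, so
    that nothing of it lies in the half-space there.\<close>
  define a where "a = - \<bar>u \<bullet> i\<bar> - 1"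
  define b where "b = \<bar>u \<bullet> i\<bar>"
  have bd: "a < x \<bullet> i \<and> x \<bullet> i \<le> b" if "x \<in> B" for x
    using u that i by (fastforce simp: mem_box a_def b_def)
  have "B \<inter> {x. x \<bullet> i \<le> a} = {}" "B \<inter> {x. x \<bullet> i \<le> b} = B" using bd by force+
  then have "g a = 0" "g b = vol B" by (simp_all add: g_def)
  moreover have "a \<le> b" by (simp add: a_def b_def)
  moreover have "0 \<le> p * vol B" "p * vol B \<le> vol B"
    using p by (auto simp: mult_left_le_one_le)
  ultimately obtain c where "g c = p * vol B"
    using IVT'[of g a "p * vol B" b] cont by auto
  then show ?thesis using that by (auto simp: g_def)
qed

lemma box_family_vol_pos:
  assumes "box_family \<D>" "D \<in> \<D>" "D \<subseteq> H" "closed H"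
  shows "0 < vol (\<Union>\<D> \<inter> H)"
proof -
  obtain a b where D: "D = cbox a b" "interior D \<noteq> {}" using assms by (meson box_family_def)
  then have "0 < vol D" using content_pos_lt_eq[of a b] by (auto simp: box_ne_empty)
  also have "vol D \<le> vol (\<Union>\<D> \<inter> H)"
    using assms D box_family_compact[OF assms(1)]
    by (intro measure_mono_fmeasurable) (auto intro!: lmeasurable_compact compact_Int_closed)
  finally show ?thesis .
qed

lemma interval_cuts:
  fixes i :: "'a::euclidean_space"
  assumes "i \<in> Basis"
  shows "\<exists>a' b'. cbox a b \<inter> {x. x \<bullet> i \<le> c} = cbox a' b'" "\<exists>a' b'. cbox a b \<inter> {x. x \<bullet> i \<ge> c} = cbox a' b'"
  using interval_split[OF assms, of a b c] by blast+

text \<open>Both unions are cut in the same proportion by parallel hyperplanes, so that the two induction hypotheses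
  add up; the cut of \<open>\<A>\<close> separates two of its boxes, which makes both halves have fewer boxes.\<close>

lemma hadwiger_ohmann_step:
  fixes \<A> \<B> :: "'a::euclidean_space set set"
  assumes IH: "\<And>\<A>' \<B>' :: 'a set set. card \<A>' + card \<B>' < card \<A> + card \<B> \<Longrightarrow> box_family \<A>' \<Longrightarrow> box_family \<B>' \<Longrightarrow>
      vol (\<Union>\<A>') powr (1 - t) * vol (\<Union>\<B>') powr t \<le> vol (conv_sum t (\<Union>\<A>') (\<Union>\<B>'))"
    and t: "0 < t" "t < 1" and \<A>: "box_family \<A>" and \<B>: "box_family \<B>"
    and i: "i \<in> Basis"
    and D: "D1 \<in> \<A>" "D2 \<in> \<A>" "D1 \<subseteq> {x. x \<bullet> i \<le> c}" "D2 \<subseteq> {x. x \<bullet> i \<ge> c}"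
  shows "vol (\<Union>\<A>) powr (1 - t) * vol (\<Union>\<B>) powr t \<le> vol (conv_sum t (\<Union>\<A>) (\<Union>\<B>))"
proof -
  let ?L = "\<lambda>c. {x::'a. x \<bullet> i \<le> c}" and ?U = "\<lambda>c. {x::'a. x \<bullet> i \<ge> c}"
  let ?A = "\<Union>\<A>" and ?B = "\<Union>\<B>"
  have cl: "closed (?L c)" "closed (?U c)" for c
    using closed_halfspace_le[of i c] closed_halfspace_ge[of c i] by (simp_all add: inner_commute)
  have cA: "compact ?A" and cB: "compact ?B" using \<A> \<B> by (auto intro: box_family_compact)
  have pos: "0 < vol (?A \<inter> ?L c)" "0 < vol (?A \<inter> ?U c)"
    using box_family_vol_pos \<A> D cl by blast+
  have Asum: "vol (?A \<inter> ?L c) + vol (?A \<inter> ?U c) = vol ?A"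
    by (rule compact_halfspace_parts[OF cA i])
  define p where "p = vol (?A \<inter> ?L c) / vol ?A"
  have p: "0 \<le> p" "p \<le> 1" and pA: "vol (?A \<inter> ?L c) = p * vol ?A" "vol (?A \<inter> ?U c) = (1 - p) * vol ?A"
  proof -
    have "vol ?A > 0" using pos Asum by linarith
    then show "0 \<le> p" "p \<le> 1" "vol (?A \<inter> ?L c) = p * vol ?A"
      using pos Asum by (simp_all add: p_def)
    then show "vol (?A \<inter> ?U c) = (1 - p) * vol ?A"
      using Asum by (simp add: algebra_simps)
  qed
  obtain c' where c': "vol (?B \<inter> ?L c') = p * vol ?B"
    using halfspace_fraction[OF cB i p] .
  then have pB: "vol (?B \<inter> ?U c') = (1 - p) * vol ?B"
    using compact_halfspace_parts[OF cB i, of c'] by (simp add: algebra_simps)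
  \<comment> \<open>\<open>D2\<close> meets the lower half-space, and \<open>D1\<close> the upper
    one, only in the hyperplane. Each half of \<A> therefore loses a box, while the halves of \<B>
    merely do not gain any.\<close>
  have emp: "interior (D2 \<inter> ?L c) = {}" "interior (D1 \<inter> ?U c) = {}"
  proof -
    have "D2 \<inter> ?L c \<subseteq> {x. x \<bullet> i = c}" "D1 \<inter> ?U c \<subseteq> {x. x \<bullet> i = c}" using D by auto
    then show "interior (D2 \<inter> ?L c) = {}" "interior (D1 \<inter> ?U c) = {}"
      using negligible_coordinate_plane[OF i, of c] open_not_negligible[OF open_interior]
      by (meson interior_subset negligible_subset order.trans)+
  qed
  note cutL = cut_family[where H = "?L c" for c, OF _ interval_cuts(1)[OF i]]
  note cutU = cut_family[where H = "?U c" for c, OF _ interval_cuts(2)[OF i]]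
  have part: "q * (vol ?A powr (1 - t) * vol ?B powr t) \<le> vol (conv_sum t (?A \<inter> H) (?B \<inter> H'))"
    if q: "0 \<le> q" "vol (?A \<inter> H) = q * vol ?A" "vol (?B \<inter> H') = q * vol ?B" and H: "closed H" "closed H'"
      and fam: "box_family (cut_family H \<A>)" "box_family (cut_family H' \<B>)"
      and card: "card (cut_family H \<A>) < card \<A>" "card (cut_family H' \<B>) \<le> card \<B>"
      and vol: "vol (\<Union>(cut_family H \<A>)) = vol (?A \<inter> H)" "vol (\<Union>(cut_family H' \<B>)) = vol (?B \<inter> H')"
      and sub: "\<Union>(cut_family H \<A>) \<subseteq> ?A \<inter> H" "\<Union>(cut_family H' \<B>) \<subseteq> ?B \<inter> H'" for q H H'
  proof -
    have "q * (vol ?A powr (1 - t) * vol ?B powr t)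
        = vol (\<Union>(cut_family H \<A>)) powr (1 - t) * vol (\<Union>(cut_family H' \<B>)) powr t"
      using q vol by (simp add: powr_weighted_split)
    also have "\<dots> \<le> vol (conv_sum t (\<Union>(cut_family H \<A>)) (\<Union>(cut_family H' \<B>)))"
      by (rule IH) (use card fam in auto)
    also have "\<dots> \<le> vol (conv_sum t (?A \<inter> H) (?B \<inter> H'))"
      using fam H cA cB sub \<A> \<B>
      by (intro measure_mono_fmeasurable conv_sum_mono lmeasurable_compact fmeasurableD
          compact_conv_sum compact_Int_closed box_family_compact)
    finally show ?thesis .
  qed
  have L: "p * (vol ?A powr (1 - t) * vol ?B powr t) \<le> vol (conv_sum t (?A \<inter> ?L c) (?B \<inter> ?L c'))"
    by (rule part) (use p pA c' cl cutL[OF \<A>] cutL[OF \<B>] cutL(5)[OF \<A> D(2) emp(1)] in auto)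
  have U: "(1 - p) * (vol ?A powr (1 - t) * vol ?B powr t) \<le> vol (conv_sum t (?A \<inter> ?U c) (?B \<inter> ?U c'))"
    by (rule part) (use p pA pB cl cutU[OF \<A>] cutU[OF \<B>] cutU(5)[OF \<A> D(1) emp(2)] in auto)
  \<comment> \<open>The sum of the lower parts and the sum of the upper parts lie on opposite sides
    of the hyperplane at height \<open>?c\<close>, so their volumes add up inside
    \<open>?C\<close>.\<close>
  let ?C = "conv_sum t ?A ?B" and ?c = "(1 - t) * c + t * c'"
  have "conv_sum t (?A \<inter> ?L c) (?B \<inter> ?L c') \<subseteq> ?C \<inter> ?L ?c"
    using t by (auto elim!: conv_sumE intro!: conv_sumI add_mono mult_left_mono simp: inner_add_left)
  moreover have "conv_sum t (?A \<inter> ?U c) (?B \<inter> ?U c') \<subseteq> ?C \<inter> ?U ?c"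
    using t by (auto elim!: conv_sumE intro!: conv_sumI add_mono mult_left_mono simp: inner_add_left)
  ultimately have "vol (conv_sum t (?A \<inter> ?L c) (?B \<inter> ?L c')) \<le> vol (?C \<inter> ?L ?c)"
    "vol (conv_sum t (?A \<inter> ?U c) (?B \<inter> ?U c')) \<le> vol (?C \<inter> ?U ?c)"
    using cA cB cl by (auto intro!: measure_mono_fmeasurable lmeasurable_compact fmeasurableD compact_conv_sum compact_Int_closed)
  moreover have "vol (?C \<inter> ?L ?c) + vol (?C \<inter> ?U ?c) = vol ?C"
    by (intro compact_halfspace_parts compact_conv_sum cA cB i)
  ultimately show ?thesis using L U by (simp add: algebra_simps)
qed

text \<open>Two boxes have disjoint interiors only if in some coordinate their open side intervals
  are disjoint; the degenerate alternatives are excluded by the nonempty interiors.\<close>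

lemma box_family_separate:
  assumes "box_family \<D>" "card \<D> \<ge> 2"
  obtains i c D1 D2 where "i \<in> Basis" "D1 \<in> \<D>" "D2 \<in> \<D>" "D1 \<subseteq> {x. x \<bullet> i \<le> c}" "D2 \<subseteq> {x. x \<bullet> i \<ge> c}"
proof -
  obtain D E where DE: "D \<in> \<D>" "E \<in> \<D>" "D \<noteq> E"
    using assms(2) by (metis card_le_Suc0_iff_eq box_family_def assms(1) not_less_eq_eq numeral_2_eq_2)
  then have disj: "interior D \<inter> interior E = {}"
    using assms(1) unfolding box_family_def by (blast dest: pairwiseD)
  obtain a b where D: "D = cbox a b" "interior D \<noteq> {}" using DE assms(1) unfolding box_family_def by meson
  obtain c d where E: "E = cbox c d" "interior E \<noteq> {}" using DE assms(1) unfolding box_family_def by meson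
  have "\<forall>i\<in>Basis. a \<bullet> i < b \<bullet> i \<and> c \<bullet> i < d \<bullet> i"
    using D E by (auto simp: box_ne_empty)
  moreover have "\<exists>i\<in>Basis. (b\<bullet>i \<le> a\<bullet>i \<or> d\<bullet>i \<le> c\<bullet>i \<or> b\<bullet>i \<le> c\<bullet>i \<or> d\<bullet>i \<le> a\<bullet>i)"
    using disj D E disjoint_interval(4)[of a b c d] by simp
  ultimately obtain i where i: "i \<in> Basis" "b \<bullet> i \<le> c \<bullet> i \<or> d \<bullet> i \<le> a \<bullet> i" by force
  from i(2) show thesis
  proof
    assume "b \<bullet> i \<le> c \<bullet> i"
    then have "D \<subseteq> {x. x \<bullet> i \<le> b \<bullet> i}" "E \<subseteq> {x. x \<bullet> i \<ge> b \<bullet> i}"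
      using i(1) D E by (force simp: mem_box)+
    then show thesis using that DE i(1) by blast
  next
    assume "d \<bullet> i \<le> a \<bullet> i"
    then have "E \<subseteq> {x. x \<bullet> i \<le> d \<bullet> i}" "D \<subseteq> {x. x \<bullet> i \<ge> d \<bullet> i}"
      using i(1) D E by (force simp: mem_box)+
    then show thesis using that DE i(1) by blast
  qed
qed

text \<open>Induction on the total number of boxes. The cutting step wants its two separated boxes
  in the first family; if they are in the second, the roles are exchanged, which replaces t by 1 -
  t. For this reason the induction is over all t.\<close>

lemma brunn_minkowski_box_family:
  fixes \<A> \<B> :: "'a::euclidean_space set set"
  assumes "0 < t" "t < 1" "box_family \<A>" "box_family \<B>"
  shows "vol (\<Union>\<A>) powr (1 - t) * vol (\<Union>\<B>) powr t \<le> vol (conv_sum t (\<Union>\<A>) (\<Union>\<B>))"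
  using assms
proof (induction "card \<A> + card \<B>" arbitrary: \<A> \<B> t rule: less_induct)
  case less
  have fin: "finite \<A>" "finite \<B>" using less.prems by (auto simp: box_family_def)
  consider "card \<A> \<ge> 2" | "card \<B> \<ge> 2" | "\<A> = {} \<or> \<B> = {}" | "card \<A> = 1" "card \<B> = 1"
    using fin by (metis One_nat_def Suc_leI card_gt_0_iff le_antisym not_less_eq_eq numeral_2_eq_2)
  then show ?case
  proof cases
    case 1
    then show ?thesis
      using box_family_separate[OF less.prems(3)] hadwiger_ohmann_step[where \<A> = \<A> and \<B> = \<B>] less by metis
  next
    case 2
    obtain i c D1 D2 where sep: "i \<in> Basis" "D1 \<in> \<B>" "D2 \<in> \<B>" "D1 \<subseteq> {x. x \<bullet> i \<le> c}" "D2 \<subseteq> {x. x \<bullet> i \<ge> c}"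
      using box_family_separate[OF less.prems(4) 2] .
    have "vol (\<Union>\<B>) powr (1 - (1 - t)) * vol (\<Union>\<A>) powr (1 - t) \<le> vol (conv_sum (1 - t) (\<Union>\<B>) (\<Union>\<A>))"
    proof (rule hadwiger_ohmann_step[OF _ _ _ _ _ sep])
      fix \<A>' \<B>' :: "'a set set"
      assume "card \<A>' + card \<B>' < card \<B> + card \<A>" and fam: "box_family \<A>'" "box_family \<B>'"
      then show "vol (\<Union>\<A>') powr (1 - (1 - t)) * vol (\<Union>\<B>') powr (1 - t) \<le> vol (conv_sum (1 - t) (\<Union>\<A>') (\<Union>\<B>'))"
        using less.prems fam by (intro less.hyps) (auto simp: add.commute)
    qed (use less.prems in auto)
    then show ?thesis by (simp add: conv_sum_commute[of t] mult.commute)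
  next
    case 3
    then show ?thesis by (auto simp: conv_sum_def)
  next
    case 4
    then obtain D E where DE: "\<A> = {D}" "\<B> = {E}" by (meson card_1_singletonE)
    then have "interior D \<noteq> {} \<and> (\<exists>a b. D = cbox a b)" "interior E \<noteq> {} \<and> (\<exists>a b. E = cbox a b)"
      using less.prems unfolding box_family_def by blast+
    then obtain a b c d where "D = cbox a b" "interior D \<noteq> {}" "E = cbox c d" "interior E \<noteq> {}"
      by blast
    then show ?thesis
      using brunn_minkowski_box[of t a b c d] DE less.prems(1,2) by (simp add: box_ne_empty)
  qed
qed

text \<open>Finitely many small open boxes, each in a ball about a point of \<open>A\<close>, cover
  \<open>A\<close>. A common division of their closures has disjoint interiors, and its flat members
  are negligible.\<close>

lemma box_family_approx:
  fixes A :: "'a::euclidean_space set"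
  assumes A: "compact A" and e: "e > 0"
  obtains \<A> where "box_family \<A>" "vol A \<le> vol (\<Union>\<A>)" "\<And>x. x \<in> \<Union>\<A> \<Longrightarrow> \<exists>a\<in>A. dist a x < e"
proof -
  have "\<forall>x\<in>A. \<exists>a b. x \<in> box a b \<and> cbox a b \<subseteq> ball x e"
    using e by (metis open_ball centre_in_ball open_contains_cbox)
  then obtain f g where fg: "\<And>x. x \<in> A \<Longrightarrow> x \<in> box (f x) (g x) \<and> cbox (f x) (g x) \<subseteq> ball x e"
    by metis
  have cover: "A \<subseteq> (\<Union>x\<in>A. box (f x) (g x))" using fg by blast
  obtain C where C: "C \<subseteq> A" "finite C" "A \<subseteq> (\<Union>x\<in>C. box (f x) (g x))"
    by (rule compactE_image[OF A open_box cover])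
  obtain p where p: "p division_of (\<Union>((\<lambda>x. cbox (f x) (g x)) ` C))"
    using C(2) elementary_unions_intervals[of "(\<lambda>x. cbox (f x) (g x)) ` C"] by blast
  define \<A> where "\<A> = {D \<in> p. interior D \<noteq> {}}"
  have "box_family \<A>"
    unfolding box_family_def
  proof (intro conjI ballI)
    show "finite \<A>" using division_ofD(1)[OF p] by (simp add: \<A>_def)
    show "pairwise (\<lambda>D E. interior D \<inter> interior E = {}) \<A>"
      using division_ofD(5)[OF p] unfolding pairwise_def \<A>_def by blast
  next
    fix D assume "D \<in> \<A>"
    then show "interior D \<noteq> {}" "\<exists>a b. D = cbox a b"
      using division_ofD(4)[OF p] unfolding \<A>_def by blast+
  qed
  moreover have "vol A \<le> vol (\<Union>\<A>)"
  proof -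
    let ?N = "\<Union>{D \<in> p. interior D = {}}"
    have "negligible ?N"
    proof (rule negligible_Union)
      show "finite {D \<in> p. interior D = {}}" using division_ofD(1)[OF p] by simp
      fix D assume D: "D \<in> {D \<in> p. interior D = {}}"
      then obtain a b where "D = cbox a b" using division_ofD(4)[OF p] by blast
      then show "negligible D" using D by (simp add: negligible_interval)
    qed
    then have N: "?N \<in> null_sets lebesgue" "?N \<in> lmeasurable"
      by (simp_all only: negligible_iff_null_sets[symmetric] negligible_iff_measure)
    have m: "\<Union>\<A> \<in> lmeasurable" by (intro lmeasurable_compact box_family_compact \<open>box_family \<A>\<close>)
    have vN: "vol (\<Union>\<A> \<union> ?N) = vol (\<Union>\<A>)" by (rule measure_Un_null_set[OF fmeasurableD[OF m] N(1)])
    have mN: "\<Union>\<A> \<union> ?N \<in> lmeasurable" by (rule fmeasurable.Un[OF m N(2)])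
    have "A \<subseteq> \<Union>\<A> \<union> ?N"
    proof
      fix x assume "x \<in> A"
      then have "x \<in> \<Union>((\<lambda>x. cbox (f x) (g x)) ` C)"
        using C(3) box_subset_cbox by blast
      then show "x \<in> \<Union>\<A> \<union> ?N" unfolding \<A>_def division_ofD(6)[OF p, symmetric] by blast
    qed
    from measure_mono_fmeasurable[OF this fmeasurableD[OF lmeasurable_compact[OF A]] mN] vN
    show ?thesis by simp
  qed
  moreover have "\<exists>a\<in>A. dist a x < e" if "x \<in> \<Union>\<A>" for x
  proof -
    have "x \<in> \<Union>((\<lambda>x. cbox (f x) (g x)) ` C)"
      using that unfolding \<A>_def division_ofD(6)[OF p, symmetric] by blast
    then obtain a where "a \<in> C" "x \<in> cbox (f a) (g a)" by blast
    then show ?thesis using fg C(1) by (metis mem_ball subsetD)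
  qed
  ultimately show thesis using that by blast
qed

text \<open>Approximation from outside: choose an open \<open>T\<close> around the compact sum with
  almost the same volume, and d such that the d-neighbourhood of the sum stays in \<open>T\<close>.
  Box families within distance d of \<open>A\<close> and \<open>B\<close> then have their sum in
  \<open>T\<close>.\<close>

theorem brunn_minkowski:
  fixes A B :: "'a::euclidean_space set"
  assumes t: "0 < t" "t < 1" and A: "compact A" and B: "compact B"
  shows "vol A powr (1 - t) * vol B powr t \<le> vol (conv_sum t A B)"
proof (rule field_le_epsilon)
  fix e :: real assume e: "e > 0"
  let ?C = "conv_sum t A B"
  have C: "compact ?C" using A B by (rule compact_conv_sum)
  have Cm: "?C \<in> lmeasurable" using C by (rule lmeasurable_compact)
  obtain T where T: "open T" "?C \<subseteq> T" and TC: "T - ?C \<in> lmeasurable" "emeasure lebesgue (T - ?C) < ennreal e"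
    using sets_lebesgue_outer_open[OF fmeasurableD[OF Cm] e] .
  have Tm: "T \<in> lmeasurable" "vol T < vol ?C + e"
  proof -
    have "T = ?C \<union> (T - ?C)" using T by auto
    then show "T \<in> lmeasurable" using fmeasurable.Un[OF Cm TC(1)] by metis
    have "vol (T - ?C) < e" using TC(2) e by (simp add: emeasure_eq_measure2[OF TC(1)] ennreal_less_iff)
    moreover have "vol T = vol ?C + vol (T - ?C)"
      using measure_Un2[OF Cm \<open>T \<in> lmeasurable\<close>] T by (simp add: Un_absorb1)
    ultimately show "vol T < vol ?C + e" by simp
  qed
  obtain d where d: "d > 0" "(\<Union>x\<in>?C. ball x d) \<subseteq> T"
    using compact_subset_open_imp_ball_epsilon_subset[OF C T] by blast
  obtain \<A> where \<A>: "box_family \<A>" "vol A \<le> vol (\<Union>\<A>)" "\<And>x. x \<in> \<Union>\<A> \<Longrightarrow> \<exists>a\<in>A. dist a x < d"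
    using box_family_approx[OF A d(1)] by blast
  obtain \<B> where \<B>: "box_family \<B>" "vol B \<le> vol (\<Union>\<B>)" "\<And>x. x \<in> \<Union>\<B> \<Longrightarrow> \<exists>b\<in>B. dist b x < d"
    using box_family_approx[OF B d(1)] by blast
  have "conv_sum t (\<Union>\<A>) (\<Union>\<B>) \<subseteq> T"
  proof
    fix z assume "z \<in> conv_sum t (\<Union>\<A>) (\<Union>\<B>)"
    then obtain x y where xy: "x \<in> \<Union>\<A>" "y \<in> \<Union>\<B>" "z = (1 - t) *\<^sub>R x + t *\<^sub>R y" by (rule conv_sumE)
    obtain a b where ab: "a \<in> A" "dist a x < d" "b \<in> B" "dist b y < d" using \<A>(3) \<B>(3) xy by blast
    let ?w = "(1 - t) *\<^sub>R a + t *\<^sub>R b"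
    have "?w - z = (1 - t) *\<^sub>R (a - x) + t *\<^sub>R (b - y)" by (simp add: xy(3) algebra_simps)
    then have "norm (?w - z) \<le> (1 - t) * norm (a - x) + t * norm (b - y)"
      using t by (metis norm_triangle_ineq norm_scaleR abs_of_pos diff_gt_0_iff_gt)
    also have "\<dots> < (1 - t) * d + t * d"
      using ab t by (intro add_strict_mono mult_strict_left_mono) (auto simp: dist_norm)
    finally have "z \<in> ball ?w d" by (simp add: dist_norm algebra_simps)
    then show "z \<in> T" using d(2) conv_sumI[OF ab(1,3) refl, of t] by blast
  qed
  have "vol A powr (1 - t) * vol B powr t \<le> vol (\<Union>\<A>) powr (1 - t) * vol (\<Union>\<B>) powr t"
    using \<A>(2) \<B>(2) t by (intro mult_mono powr_mono2) auto
  also have "\<dots> \<le> vol (conv_sum t (\<Union>\<A>) (\<Union>\<B>))"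
    using t \<A>(1) \<B>(1) by (rule brunn_minkowski_box_family)
  also have "\<dots> \<le> vol T"
    using \<open>conv_sum t (\<Union>\<A>) (\<Union>\<B>) \<subseteq> T\<close> Tm(1) \<A>(1) \<B>(1)
    by (intro measure_mono_fmeasurable fmeasurableD[OF lmeasurable_compact] compact_conv_sum box_family_compact)
  finally show "vol A powr (1 - t) * vol B powr t \<le> vol ?C + e" using Tm(2) by simp
qed

section \<open>Isoperimetry in convex bodies\<close>

text \<open>The factor \<open>9\<close> makes the decay rate \<open>ln (8/9 / (1/9)) / 2 = ln 8 / 2\<close> exceed \<open>1\<close>.\<close>

lemma exponential_tail:
  fixes L :: "'a::euclidean_space set"
  assumes L: "convex L" "compact L" "0 < vol L" and R: "0 < R"
    and tail: "vol {x \<in> L. 3 * R \<le> norm (x - z)} \<le> vol L / 9" and u: "0 < u"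
  shows "vol {x \<in> L. 3 * R * (1 + u) \<le> norm (x - z)} \<le> vol L * exp (- u) / 9"
proof -
  define T where "T r = {x \<in> L. r \<le> norm (x - z)}" for r
  define C where "C = L \<inter> cball z (3 * R)"
  have cT: "compact (T r)" for r
    unfolding T_def using L(2) by (rule compact_outside_ball)
  have cC: "compact C" using L(2) by (auto simp: C_def intro: compact_Int_closed)
  let ?D = "T (3 * R * (1 + u))"
  have "vol L \<le> vol (C \<union> T (3 * R))"
    using L(2) cT cC by (intro measure_mono_fmeasurable)
      (auto simp: C_def T_def dist_norm norm_minus_commute intro!: fmeasurableD lmeasurable_compact compact_Un)
  also have "\<dots> \<le> vol C + vol (T (3 * R))"
    using cT cC by (intro measure_Un_le fmeasurableD lmeasurable_compact)
  finally have volC: "8 / 9 * vol L \<le> vol C" using tail by (simp add: T_def)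
  show ?thesis
  proof (cases "vol ?D = 0")
    case True
    then show ?thesis by (simp add: T_def)
  next
    case False
    then have D: "0 < vol ?D" by (simp add: zero_less_measure_iff)
    \<comment> \<open>This is the solution of (1 - s) (1 + u) - s = 1: mixing a point at distance at
      least 3 R (1 + u) from \<open>z\<close> with weight s of a point at distance at most 3 R
      leaves the result at distance at least 3 R.\<close>
    define s where "s = u / (u + 2)"
    have s: "0 < s" "s < 1" "(1 - s) * (u + 2) = 2" "s * (u + 2) = u"
      using u by (auto simp: s_def field_simps)
    have "conv_sum s ?D C \<subseteq> T (3 * R)"
    proof
      fix w assume "w \<in> conv_sum s ?D C"
      then obtain x y where xy: "x \<in> ?D" "y \<in> C" "w = (1 - s) *\<^sub>R x + s *\<^sub>R y" by (rule conv_sumE)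
      have "w \<in> L" unfolding xy(3) using xy(1,2) s L(1) by (intro convexD) (auto simp: T_def C_def)
      have x: "3 * R * (1 + u) \<le> norm (x - z)" and y: "norm (y - z) \<le> 3 * R"
        using xy by (auto simp: T_def C_def dist_norm norm_minus_commute)
      have "(1 - s) * (1 + u) - s = 1" using s(3) by (simp add: algebra_simps)
      then have "3 * R = 3 * R * ((1 - s) * (1 + u) - s)" by simp
      then have "3 * R = (1 - s) * (3 * R * (1 + u)) - s * (3 * R)" by (simp add: algebra_simps)
      also have "\<dots> \<le> (1 - s) * norm (x - z) - s * norm (y - z)"
        using x y s by (intro diff_mono mult_left_mono) auto
      also have "\<dots> = norm ((1 - s) *\<^sub>R (x - z)) - norm (- (s *\<^sub>R (y - z)))" using s by simp
      also have "\<dots> \<le> norm ((1 - s) *\<^sub>R (x - z) - - (s *\<^sub>R (y - z)))" by (rule norm_triangle_ineq2)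
      also have "(1 - s) *\<^sub>R (x - z) - - (s *\<^sub>R (y - z)) = w - z" by (simp add: xy(3) algebra_simps)
      finally show "w \<in> T (3 * R)" using \<open>w \<in> L\<close> by (simp add: T_def)
    qed
    then have "vol (conv_sum s ?D C) \<le> vol (T (3 * R))"
      using cT cC by (intro measure_mono_fmeasurable fmeasurableD lmeasurable_compact compact_conv_sum)
    then have "vol ?D powr (1 - s) * vol C powr s \<le> vol L / 9"
      using brunn_minkowski[OF s(1,2) cT cC, of "3 * R * (1 + u)"] tail by (simp add: T_def)
    moreover have C: "0 < vol C" using volC L(3) by linarith
    ultimately have "ln (vol ?D powr (1 - s) * vol C powr s) \<le> ln (vol L / 9)"
      using D L(3) by (intro ln_mono) auto
    then have "(1 - s) * ln (vol ?D) + s * ln (vol C) \<le> ln (vol L) - ln 9"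
      using D C L(3) by (simp add: ln_mult ln_powr ln_div)
    moreover have "ln (8 / 9 * vol L) \<le> ln (vol C)" using volC L(3) by (intro ln_mono) auto
    then have "s * (ln 8 - ln 9 + ln (vol L)) \<le> s * ln (vol C)"
      using s L(3) by (intro mult_left_mono) (auto simp: ln_mult ln_div)
    ultimately have "(1 - s) * ln (vol ?D) + s * (ln 8 - ln 9 + ln (vol L)) \<le> ln (vol L) - ln 9" by linarith
    then have "((1 - s) * ln (vol ?D) + s * (ln 8 - ln 9 + ln (vol L))) * (u + 2) \<le> (ln (vol L) - ln 9) * (u + 2)"
      using u by (intro mult_right_mono) auto
    also have "((1 - s) * ln (vol ?D) + s * (ln 8 - ln 9 + ln (vol L))) * (u + 2)
        = ((1 - s) * (u + 2)) * ln (vol ?D) + (s * (u + 2)) * (ln 8 - ln 9 + ln (vol L))" by algebra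
    finally have "2 * ln (vol ?D) + u * (ln 8 - ln 9 + ln (vol L)) \<le> (ln (vol L) - ln 9) * (u + 2)"
      by (simp only: s)
    then have "2 * ln (vol ?D) \<le> 2 * ln (vol L) - 2 * ln 9 - u * ln 8" by (simp add: algebra_simps)
    \<comment> \<open>ln 8 = 3 ln 2 and ln 2 \<ge> 2/3; this turns the factor ln 8 / 2 of the decay
      into 1.\<close>
    moreover have "ln (8::real) \<ge> 2"
      using ln2_ge_two_thirds ln_realpow[of 2 3] by simp
    then have "u * 2 \<le> u * ln 8" using u by (intro mult_left_mono) auto
    ultimately have "ln (vol ?D) \<le> ln (vol L) - ln 9 + - u" by simp
    then have "vol ?D \<le> exp (ln (vol L) - ln 9 + - u)" using D by (metis exp_le_cancel_iff exp_ln)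
    also have "\<dots> = vol L * exp (- u) / 9" using L(3) by (simp add: exp_add exp_diff exp_minus field_simps)
    finally show ?thesis by (simp add: T_def)
  qed
qed

text \<open>Since the two sums are disjoint in \<open>L\<close>, Brunn--Minkowski gives \<alpha>
  powr (1 - t) + \<beta> powr (1 - t) \<le> (1 / \<kappa>) powr t for the volume fractions \<alpha>,
  \<beta>, \<kappa> of \<open>A\<close>, \<open>B\<close> and the central part \<open>C\<close>. For
  small t the left side exceeds \<alpha> + \<beta> by at least t \<alpha> ln (1/\<alpha>), and the
  right side exceeds 1 by less; the difference must be covered by 1 - \<alpha> - \<beta>.\<close>

lemma isoperimetric_ordered:
  fixes L A B :: "'a::euclidean_space set"
  assumes L: "convex L" "compact L" "0 < vol L"
    and tail: "vol {x \<in> L. 3 * R \<le> norm (x - z)} \<le> vol L / 9"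
    and A: "compact A" "A \<subseteq> L" and B: "compact B" "B \<subseteq> L"
    and d: "0 < d" "d \<le> R" and dist: "\<And>x y. x \<in> A \<Longrightarrow> y \<in> B \<Longrightarrow> d < norm (x - y)"
    and AB: "0 < vol A" "vol A \<le> vol B"
  shows "d / (25 * R) * vol A \<le> vol (L - (A \<union> B))"
proof -
  have R: "0 < R" using d by simp
  define V \<alpha> \<beta> where "V = vol L" and "\<alpha> = vol A / V" and "\<beta> = vol B / V"
  have V: "0 < V" using L(3) by (simp add: V_def)
  have vA: "vol A = V * \<alpha>" and vB: "vol B = V * \<beta>" using V by (auto simp: \<alpha>_def \<beta>_def)
  have m: "A \<in> lmeasurable" "B \<in> lmeasurable" "L \<in> lmeasurable" using A B L by (auto intro: lmeasurable_compact)
  have "A \<inter> B = {}" using dist d by force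
  then have vAB: "vol (A \<union> B) = vol A + vol B" using m measure_Un3[of A lebesgue B] by simp
  have vM: "vol (L - (A \<union> B)) = V * (1 - \<alpha> - \<beta>)"
  proof -
    have "L = (A \<union> B) \<union> L" using A B by auto
    then have "V = vol (A \<union> B) + vol (L - (A \<union> B))"
      using measure_Un2[OF fmeasurable.Un[OF m(1,2)] m(3)] by (simp add: V_def)
    then show ?thesis using vAB vA vB by (simp add: algebra_simps)
  qed
  have "\<alpha> > 0" "\<alpha> \<le> \<beta>" using AB V by (auto simp: \<alpha>_def \<beta>_def divide_right_mono)
  have "V * (1 - \<alpha> - \<beta>) \<ge> 0" using vM by (metis measure_nonneg)
  then have sum1: "\<alpha> + \<beta> \<le> 1" using V by (simp add: zero_le_mult_iff)
  then have \<alpha>: "0 < \<alpha>" "\<alpha> \<le> 1/2" and \<beta>: "0 < \<beta>" "\<beta> \<le> 1" using \<open>\<alpha> > 0\<close> \<open>\<alpha> \<le> \<beta>\<close> by linarith+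
  \<comment> \<open>With this u the tail factor exp (- u) equals \<alpha>, so what is cut off is
    small relative to the smaller set. From \<alpha> \<le> 1/2 follows u \<ge> ln 2 \<ge>
    2/3.\<close>
  define u where "u = - ln \<alpha>"
  have "ln \<alpha> \<le> ln (1/2)" using \<alpha> by (intro ln_mono) auto
  then have u: "2/3 \<le> u" using ln2_ge_two_thirds by (simp add: u_def ln_div)
  have expu: "exp (- u) = \<alpha>" using \<alpha> by (simp add: u_def)
  define T where "T = 3 * R * (1 + u)"
  have T: "0 < T" using R u by (simp add: T_def)
  define C where "C = L \<inter> cball z T"
  have cC: "compact C" using L(2) by (auto simp: C_def intro: compact_Int_closed)
  define D where "D = {x \<in> L. T \<le> norm (x - z)}"
  have D: "vol D \<le> V * \<alpha> / 9"
    using exponential_tail[OF L R tail, of u] u by (simp add: D_def T_def V_def expu)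
  define \<kappa> where "\<kappa> = vol C / V"
  have vC: "vol C = V * \<kappa>" using V by (simp add: \<kappa>_def)
  have cD: "compact D"
    unfolding D_def using L(2) by (rule compact_outside_ball)
  have "V \<le> vol (C \<union> D)"
    unfolding V_def using L(2) cC cD by (intro measure_mono_fmeasurable)
      (auto simp: C_def D_def dist_norm norm_minus_commute intro!: fmeasurableD lmeasurable_compact compact_Un)
  also have "\<dots> \<le> vol C + vol D"
    using cC cD by (intro measure_Un_le fmeasurableD lmeasurable_compact)
  finally have "V * 1 \<le> V * (\<kappa> + \<alpha> / 9)" using D vC by (simp add: algebra_simps)
  then have \<kappa>: "1 - \<alpha> / 9 \<le> \<kappa>" using V by (simp del: mult_1_right)
  then have \<kappa>0: "0 < \<kappa>" using \<alpha> by simp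
  \<comment> \<open>Balances t * 2 T against (1 - t) d: \<open>C\<close> has diameter at most 2 T,
    so moving by t inside \<open>C\<close> cannot bridge the gap between (1 - t) \<open>A\<close>
    and (1 - t) \<open>B\<close>.\<close>
  define t where "t = d / (2 * T + d)"
  have t: "0 < t" "t < 1" using d T by (auto simp: t_def)
  have tT: "t * (2 * T) = (1 - t) * d" using d T by (simp add: t_def field_simps)
  have disj: "conv_sum t A C \<inter> conv_sum t B C = {}"
  proof (rule ccontr)
    assume "conv_sum t A C \<inter> conv_sum t B C \<noteq> {}"
    then obtain w where "w \<in> conv_sum t A C" "w \<in> conv_sum t B C" by auto
    then obtain x y c c' where x: "x \<in> A" "c \<in> C" "w = (1 - t) *\<^sub>R x + t *\<^sub>R c"
      and y: "y \<in> B" "c' \<in> C" "w = (1 - t) *\<^sub>R y + t *\<^sub>R c'"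
      by (metis conv_sumE)
    have "(1 - t) *\<^sub>R (x - y) = t *\<^sub>R (c' - c)" using x(3) y(3) by (simp add: algebra_simps)
    then have "(1 - t) * norm (x - y) = t * norm (c' - c)"
      using t by (metis abs_of_pos diff_gt_0_iff_gt norm_scaleR)
    also have "\<dots> \<le> t * (2 * T)"
    proof -
      have "norm (c' - c) \<le> norm (c' - z) + norm (z - c)" using norm_triangle_ineq[of "c' - z" "z - c"] by simp
      also have "\<dots> \<le> 2 * T" using x(2) y(2) by (simp add: C_def dist_norm norm_minus_commute)
      finally show ?thesis using t by (intro mult_left_mono) auto
    qed
    finally have "norm (x - y) \<le> d" unfolding tT using t by simp
    then show False using dist[OF x(1) y(1)] by simp
  qed
  have sub: "conv_sum t A C \<subseteq> L" "conv_sum t B C \<subseteq> L"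
    using t A B by (intro conv_sum_subset_convex[OF L(1)]; simp add: C_def)+
  have mS: "conv_sum t A C \<in> lmeasurable" "conv_sum t B C \<in> lmeasurable"
    using A B cC by (auto intro!: lmeasurable_compact compact_conv_sum)
  have "vol (conv_sum t A C) + vol (conv_sum t B C) = vol (conv_sum t A C \<union> conv_sum t B C)"
    using measure_Un3[OF mS] disj by simp
  also have "\<dots> \<le> V" unfolding V_def using sub m(3) mS by (intro measure_mono_fmeasurable) (auto simp: fmeasurableD)
  finally have "(V * \<alpha>) powr (1 - t) * (V * \<kappa>) powr t + (V * \<beta>) powr (1 - t) * (V * \<kappa>) powr t \<le> V"
    using brunn_minkowski[OF t A(1) cC] brunn_minkowski[OF t B(1) cC] by (simp add: vA vB vC)
  then have "V * (\<alpha> powr (1 - t) * \<kappa> powr t + \<beta> powr (1 - t) * \<kappa> powr t) \<le> V * 1"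
    using V \<alpha> \<beta> \<kappa>0 by (simp only: powr_weighted_split less_imp_le distrib_left mult_1_right)
  then have "(\<alpha> powr (1 - t) + \<beta> powr (1 - t)) * \<kappa> powr t \<le> 1"
    using V by (simp only: mult_le_cancel_left_pos distrib_right)
  then have "\<alpha> powr (1 - t) + \<beta> powr (1 - t) \<le> (1 / \<kappa>) powr t"
    using \<kappa>0 by (simp add: powr_divide pos_le_divide_eq)
  \<comment> \<open>The weighted arithmetic-geometric inequality for 1 / \<kappa> and 1 makes the
    right side linear in t.\<close>
  also have "\<dots> \<le> t * (1 / \<kappa>) + (1 - t) * 1"
    using Youngs_inequality_0[of t "1 - t" "1 / \<kappa>" 1] t \<kappa>0 by simp
  also have "\<dots> \<le> t * (1 + 2 * \<alpha> / 9) + (1 - t) * 1"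
  proof -
    have "1 / \<kappa> \<le> 1 / (1 - \<alpha> / 9)" using \<kappa> \<alpha> by (intro divide_left_mono) auto
    also have "\<dots> \<le> 1 + 2 * \<alpha> / 9"
    proof -
      have "\<alpha> * \<alpha> \<le> \<alpha> * (1/2)" using \<alpha> by (intro mult_left_mono) auto
      then have "1 \<le> (1 + 2 * \<alpha> / 9) * (1 - \<alpha> / 9)" using \<alpha>(1) by (simp add: algebra_simps)
      then show ?thesis using \<alpha> by (simp add: divide_le_eq)
    qed
    finally show ?thesis using t by (intro add_mono mult_left_mono) auto
  qed
  finally have up: "\<alpha> powr (1 - t) + \<beta> powr (1 - t) \<le> 1 + t * (2 * \<alpha> / 9)" using \<alpha>(1) by (simp add: algebra_simps)
  have "\<alpha> * (1 + t * u) \<le> \<alpha> * exp (t * u)" using \<alpha> by (intro mult_left_mono) auto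
  also have "\<dots> = \<alpha> powr (1 - t)" using \<alpha> by (simp add: powr_def u_def algebra_simps exp_diff exp_minus field_simps)
  finally have lA: "\<alpha> * (1 + t * u) \<le> \<alpha> powr (1 - t)" .
  have lB: "\<beta> \<le> \<beta> powr (1 - t)" using powr_mono'[of "1 - t" 1 \<beta>] \<beta> t by simp
  \<comment> \<open>The loss 2/9 is a third of the lower bound 2/3 for u, so two thirds of the gain
    remain.\<close>
  have "\<alpha> * t * (2/3 * u) \<le> \<alpha> * t * (u - 2/9)" using \<alpha> t u by (intro mult_left_mono) auto
  also have "\<dots> \<le> 1 - \<alpha> - \<beta>" using up lA lB by (simp add: algebra_simps)
  finally have main: "\<alpha> * (t * (2/3 * u)) \<le> 1 - \<alpha> - \<beta>" by (simp add: mult.assoc)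
  \<comment> \<open>Here d \<le> R and R \<le> 3/2 R u give 2 T + d \<le> 7 R + 6 R u \<le> 33/2 R
    u. The factor u cancels, leaving d / (99/4 R), and 99/4 is rounded up to 25.\<close>
  have "d / (25 * R) \<le> t * (2/3 * u)"
  proof -
    have "R * (2/3) \<le> R * u" using R u by (intro mult_left_mono) auto
    then have "2 * T + d \<le> 33/2 * R * u" unfolding T_def distrib_left using d by linarith
    then have "d * (2/3 * u) / (33/2 * R * u) \<le> d * (2/3 * u) / (2 * T + d)"
      using d T u by (intro divide_left_mono mult_pos_pos) (auto intro!: mult_nonneg_nonneg)
    moreover have "d * (2/3 * u) / (33/2 * R * u) = d / (99/4 * R)" using u R by (simp add: field_simps)
    moreover have "d / (25 * R) \<le> d / (99/4 * R)" using d R by (intro divide_left_mono) auto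
    ultimately have "d / (25 * R) \<le> d * (2/3 * u) / (2 * T + d)" by linarith
    then show ?thesis unfolding t_def times_divide_eq_left .
  qed
  then have "d / (25 * R) * (V * \<alpha>) \<le> t * (2/3 * u) * (V * \<alpha>)" using V \<alpha> by (intro mult_right_mono) auto
  also have "\<dots> \<le> V * (1 - \<alpha> - \<beta>)" using mult_left_mono[OF main, of V] V by (simp add: mult_ac)
  finally show ?thesis by (simp add: vM vA)
qed

lemma isoperimetric:
  fixes L A B :: "'a::euclidean_space set"
  assumes L: "convex L" "compact L" "0 < vol L"
    and tail: "vol {x \<in> L. 3 * R \<le> norm (x - z)} \<le> vol L / 9"
    and A: "compact A" "A \<subseteq> L" and B: "compact B" "B \<subseteq> L"
    and d: "0 < d" "d \<le> R" and dist: "\<And>x y. x \<in> A \<Longrightarrow> y \<in> B \<Longrightarrow> d < norm (x - y)"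
  shows "d / (25 * R) * min (vol A) (vol B) \<le> vol (L - (A \<union> B))"
proof (cases "min (vol A) (vol B) = 0")
  case False
  then have "0 < vol A" "0 < vol B" by (auto simp: zero_less_measure_iff)
  then show ?thesis
    using isoperimetric_ordered[OF L tail A B d] isoperimetric_ordered[OF L tail B A d] dist
    by (cases "vol A \<le> vol B") (force simp: min_def norm_minus_commute Un_commute)+
qed simp

section \<open>Axis-disjoint subsets of a box\<close>

definition mix :: "'n set \<Rightarrow> real ^ 'n \<Rightarrow> real ^ 'n \<Rightarrow> real ^ 'n" where
  "mix J x y = (\<chi> i. if i \<in> J then y $ i else x $ i)"

lemma mix_nth [simp]: "mix J x y $ i = (if i \<in> J then y $ i else x $ i)"
  by (simp add: mix_def)

lemma emeasure_box_cart:
  fixes a b :: "real ^ 'n"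
  assumes "\<And>i. a $ i \<le> b $ i"
  shows "emeasure lborel (box a b) = ennreal (\<Prod>i\<in>UNIV. b $ i - a $ i)"
proof -
  have "\<And>i. i \<in> Basis \<Longrightarrow> a \<bullet> i \<le> b \<bullet> i" using assms by (auto simp: Basis_vec_def inner_axis)
  then have "emeasure lborel (box a b) = emeasure lborel (cbox a b)" by simp
  also have "\<dots> = ennreal (measure lborel (cbox a b))"
    by (intro emeasure_eq_ennreal_measure) (metis emeasure_lborel_cbox_finite less_irrefl infinity_ennreal_def)
  also have "measure lborel (cbox a b) = (\<Prod>i\<in>UNIV. b $ i - a $ i)"
    using assms by (intro content_cbox_cart) (auto simp: interval_ne_empty_cart)
  finally show ?thesis .
qed

text \<open>Keeping both mixed points makes the exchange a measure-preserving involution of pairs.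
  Thus each point on the exchange path is uniform when the two starting points are independent and
  uniform.\<close>

definition swap_coords :: "'n set \<Rightarrow> (real ^ 'n) \<times> (real ^ 'n) \<Rightarrow> (real ^ 'n) \<times> (real ^ 'n)" where
  "swap_coords J p = (mix J (fst p) (snd p), mix J (snd p) (fst p))"

lemma measurable_swap_coords [measurable]:
  fixes J :: "'n::finite set"
  shows "swap_coords J \<in> borel \<rightarrow>\<^sub>M borel"
proof -
  have mix: "continuous_on UNIV (\<lambda>p. mix J (f p) (g p))"
    if "continuous_on UNIV f" "continuous_on UNIV g" for f g :: "(real ^ 'n) \<times> (real ^ 'n) \<Rightarrow> real ^ 'n"
    unfolding mix_def
  proof (intro continuous_on_vec_lambda)
    fix i show "continuous_on UNIV (\<lambda>p. if i \<in> J then g p $ i else f p $ i)"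
      using that by (cases "i \<in> J") (auto intro!: continuous_intros)
  qed
  have "continuous_on UNIV (swap_coords J)"
    unfolding swap_coords_def by (intro continuous_on_Pair mix continuous_intros)
  then show ?thesis by (rule borel_measurable_continuous_onI)
qed

text \<open>Lebesgue measure is determined by its values on boxes. The preimage of a box under the
  exchange is the box with the corresponding sides exchanged, which has the same product of side
  lengths.\<close>

lemma distr_swap_coords: "distr lborel borel (swap_coords J) = (lborel :: ((real ^ 'n) \<times> (real ^ 'n)) measure)"
proof (rule sym, rule lborel_eqI)
  show "sets (distr lborel borel (swap_coords J)) = sets borel" by simp
  fix l u :: "(real ^ 'n) \<times> (real ^ 'n)"
  assume lu: "\<And>b. b \<in> Basis \<Longrightarrow> l \<bullet> b \<le> u \<bullet> b"
  obtain a c where l: "l = (a, c)" by (cases l)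
  obtain b d where u: "u = (b, d)" by (cases u)
  have ab: "a $ i \<le> b $ i" for i
    using lu[of "(axis i 1, 0)"] by (simp add: l u in_Basis_prod_iff axis_in_Basis_iff inner_axis)
  have cd: "c $ i \<le> d $ i" for i
    using lu[of "(0, axis i 1)"] by (simp add: l u in_Basis_prod_iff axis_in_Basis_iff inner_axis)
  have times: "emeasure lborel (box p q \<times> box r s) = ennreal (\<Prod>i\<in>UNIV. (q $ i - p $ i) * (s $ i - r $ i))"
    if "\<And>i. p $ i \<le> q $ i" "\<And>i. r $ i \<le> s $ i" for p q r s :: "real ^ 'n"
  proof -
    have "emeasure lborel (box p q \<times> box r s) = emeasure lborel (box p q) * emeasure lborel (box r s)"
      by (simp flip: lborel_prod add: lborel.emeasure_pair_measure_Times)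
    also have "\<dots> = ennreal ((\<Prod>i\<in>UNIV. q $ i - p $ i) * (\<Prod>i\<in>UNIV. s $ i - r $ i))"
      using that by (simp add: emeasure_box_cart ennreal_mult prod_nonneg)
    finally show ?thesis by (simp add: prod.distrib)
  qed
  have box_Times: "box (p, r) (q, s) = box p q \<times> box r s" for p q r s :: "real ^ 'n"
    by (auto simp: box_def Basis_prod_def ball_Un)
  have vimage: "swap_coords J -` (box a b \<times> box c d)
      = box (mix J a c) (mix J b d) \<times> box (mix J c a) (mix J d b)"
    by (auto simp: swap_coords_def mem_box_cart split: if_splits)
  have "emeasure (distr lborel borel (swap_coords J)) (box l u)
      = emeasure lborel (swap_coords J -` (box a b \<times> box c d))"
    unfolding l u box_Times
    by (subst emeasure_distr) (auto intro!: borel_open open_Times open_box)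
  also have "\<dots> = ennreal (\<Prod>i\<in>UNIV. (mix J b d $ i - mix J a c $ i) * (mix J d b $ i - mix J c a $ i))"
    unfolding vimage using ab cd by (intro times) auto
  also have "(\<Prod>i\<in>UNIV. (mix J b d $ i - mix J a c $ i) * (mix J d b $ i - mix J c a $ i))
      = (\<Prod>i\<in>UNIV. (b $ i - a $ i) * (d $ i - c $ i))"
    by (intro prod.cong) auto
  also have "ennreal \<dots> = emeasure lborel (box l u)"
    using times[OF ab cd] by (simp add: l u box_Times)
  also have "\<dots> = (\<Prod>b\<in>Basis. (u - l) \<bullet> b)"
    using lu by simp
  finally show "emeasure (distr lborel borel (swap_coords J)) (box l u) = (\<Prod>b\<in>Basis. (u - l) \<bullet> b)" .
qed

lemma emeasure_swap_coords:
  fixes S T :: "(real ^ 'n) set"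
  assumes [measurable]: "S \<in> sets borel" "T \<in> sets borel"
  shows "emeasure lborel (swap_coords J -` (S \<times> T)) = emeasure lborel S * emeasure lborel T"
proof -
  have ST: "S \<times> T \<in> sets borel" by (metis assms borel_prod pair_measureI)
  have "emeasure lborel (swap_coords J -` (S \<times> T)) = emeasure (distr lborel borel (swap_coords J)) (S \<times> T)"
    using ST by (simp add: emeasure_distr)
  also have "\<dots> = emeasure (lborel \<Otimes>\<^sub>M lborel) (S \<times> T)" by (simp add: distr_swap_coords lborel_prod)
  also have "\<dots> = emeasure lborel S * emeasure lborel T"
    by (simp add: lborel.emeasure_pair_measure_Times)
  finally show ?thesis .
qed

text \<open>Consecutive points of the path agree off one coordinate, hence in at least n - 1 places,
  so the path cannot step directly from \<open>S1\<close> to \<open>S2\<close>. The visit to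
  \<open>S3\<close> happens strictly between \<open>x\<close> and \<open>y\<close>, which leaves n -
  1 positions.\<close>

lemma coordinate_path_hits:
  fixes S1 S2 S3 C :: "(real ^ 'n) set" and xs :: "'n list"
  assumes xs: "distinct xs" "set xs = UNIV"
    and disj: "axis_disjoint S1 S2" and cover: "C \<subseteq> S1 \<union> S2 \<union> S3"
    and mix: "\<And>J. mix J x y \<in> C" and x: "x \<in> S1" and y: "y \<in> S2"
  shows "\<exists>k\<in>{1..<CARD('n)}. mix (set (take k xs)) x y \<in> S3"
proof (rule ccontr)
  assume no: "\<not> ?thesis"
  have len: "length xs = CARD('n)" using xs distinct_card by metis
  let ?z = "\<lambda>k. mix (set (take k xs)) x y"
  have step: "?z (Suc k) \<notin> S2" if k: "k < CARD('n)" "?z k \<in> S1" for k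
  proof
    assume "?z (Suc k) \<in> S2"
    then have "int (card {i. ?z k $ i = ?z (Suc k) $ i}) \<le> int CARD('n) - 2"
      using disj k(2) unfolding axis_disjoint_def by blast
    moreover have "card (UNIV - {xs ! k}) \<le> card {i. ?z k $ i = ?z (Suc k) $ i}"
    proof (rule card_mono)
      show "UNIV - {xs ! k} \<subseteq> {i. ?z k $ i = ?z (Suc k) $ i}"
        using k len by (auto simp: take_Suc_conv_app_nth)
    qed simp
    moreover have "card (UNIV - {xs ! k}) = CARD('n) - 1" by (simp add: card_Diff_singleton)
    moreover have "1 \<le> CARD('n)" by (simp add: Suc_leI)
    ultimately show False by (simp add: of_nat_diff)
  qed
  have in1: "k < CARD('n) \<Longrightarrow> ?z k \<in> S1" for k
  proof (induction k)
    case 0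
    have "mix {} x y = x" by (simp add: vec_eq_iff)
    then show ?case using x by simp
  next
    case (Suc k)
    then have "?z (Suc k) \<notin> S2" "?z (Suc k) \<notin> S3" using step[of k] no by auto
    then show ?case using mix cover by blast
  qed
  have "?z CARD('n) = y" using len xs by (simp add: vec_eq_iff)
  then show False using step[of "CARD('n) - 1"] in1[of "CARD('n) - 1"] y by simp
qed

text \<open>A union bound over the n - 1 intermediate positions: every pair in the product of the
  two parts passes through \<open>S3\<close>, and for a fixed position the pairs doing so have
  measure vol (S3 \<inter> C) * vol C.\<close>

lemma axis_disjoint_box:
  fixes S1 S2 S3 :: "(real ^ 'n) set" and a b :: "real ^ 'n"
  defines "C \<equiv> cbox a b"
  assumes [measurable]: "S1 \<in> sets borel" "S2 \<in> sets borel" "S3 \<in> sets borel"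
    and disj: "axis_disjoint S1 S2" and cover: "C \<subseteq> S1 \<union> S2 \<union> S3"
  shows "measure lborel (S1 \<inter> C) * measure lborel (S2 \<inter> C)
    \<le> (real CARD('n) - 1) * (measure lborel (S3 \<inter> C) * measure lborel C)"
proof -
  have [measurable]: "C \<in> sets borel" by (simp add: C_def)
  obtain xs :: "'n list" where xs: "set xs = UNIV" "distinct xs"
    using finite_distinct_list[of "UNIV :: 'n set"] by auto
  let ?J = "\<lambda>k. set (take k xs)"
  let ?W = "\<lambda>k. swap_coords (?J k) -` ((S3 \<inter> C) \<times> C)"
  have mixC: "mix J x y \<in> C" if "x \<in> C" "y \<in> C" for J x y
    using that by (auto simp: C_def mem_box_cart)
  have sub: "(S1 \<inter> C) \<times> (S2 \<inter> C) \<subseteq> (\<Union>k\<in>{1..<CARD('n)}. ?W k)"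
  proof (rule subsetI)
    fix p assume "p \<in> (S1 \<inter> C) \<times> (S2 \<inter> C)"
    then obtain x y where p: "p = (x, y)" "x \<in> S1" "x \<in> C" "y \<in> S2" "y \<in> C" by auto
    obtain k where "k \<in> {1..<CARD('n)}" "mix (?J k) x y \<in> S3"
      using coordinate_path_hits[OF xs(2,1) disj cover mixC[OF p(3,5)] p(2,4)] by blast
    then show "p \<in> (\<Union>k\<in>{1..<CARD('n)}. ?W k)"
      using p mixC by (auto simp: swap_coords_def)
  qed
  have W: "?W k \<in> sets borel" for k
  proof -
    have "(S3 \<inter> C) \<times> C \<in> sets borel"
      by (subst borel_prod[symmetric]) (rule pair_measureI; measurable)
    then show ?thesis using measurable_sets[OF measurable_swap_coords, of "(S3 \<inter> C) \<times> C"] by simp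
  qed
  have fin: "emeasure lborel (S \<inter> C) = ennreal (measure lborel (S \<inter> C))" if "S \<in> sets borel" for S
  proof -
    have "emeasure lborel (S \<inter> C) \<le> emeasure lborel C" using that by (intro emeasure_mono) auto
    also have "\<dots> < \<infinity>" unfolding C_def by (rule emeasure_lborel_cbox_finite)
    finally show ?thesis by (intro emeasure_eq_ennreal_measure) auto
  qed
  have "ennreal (measure lborel (S1 \<inter> C) * measure lborel (S2 \<inter> C))
      = emeasure lborel (S1 \<inter> C) * emeasure lborel (S2 \<inter> C)"
    by (simp add: fin ennreal_mult)
  also have "\<dots> = emeasure lborel ((S1 \<inter> C) \<times> (S2 \<inter> C))"
    by (simp add: lborel.emeasure_pair_measure_Times flip: lborel_prod)
  also have "\<dots> \<le> emeasure lborel (\<Union>k\<in>{1..<CARD('n)}. ?W k)"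
    using sub W by (intro emeasure_mono) (auto intro!: sets.finite_UN)
  also have "\<dots> \<le> (\<Sum>k\<in>{1..<CARD('n)}. emeasure lborel (?W k))"
    using W by (intro emeasure_subadditive_finite) auto
  also have "\<dots> = (\<Sum>k\<in>{1..<CARD('n)}. ennreal (measure lborel (S3 \<inter> C) * measure lborel C))"
    using fin[of UNIV] by (simp add: emeasure_swap_coords fin ennreal_mult del: vimage_Times)
  also have "\<dots> = ennreal ((real CARD('n) - 1) * (measure lborel (S3 \<inter> C) * measure lborel C))"
  proof -
    have "1 \<le> CARD('n)" by (simp add: Suc_leI)
    then have "real (card {1..<CARD('n)}) = real CARD('n) - 1" by simp
    then show ?thesis
      by (simp only: sum_constant ennreal_of_nat_eq_real_of_nat) (simp add: ennreal_mult' \<open>1 \<le> CARD('n)\<close>)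
  qed
  finally show ?thesis
    by (subst (asm) ennreal_le_iff) (auto intro!: mult_nonneg_nonneg simp: Suc_leI)
qed

section \<open>Averages over cubes\<close>

text \<open>The closed sup-norm ball, so the side length is \<open>2 * r\<close>.\<close>

definition cube :: "real \<Rightarrow> real ^ 'n \<Rightarrow> (real ^ 'n) set" where
  "cube r x = cbox (x - vec r) (x + vec r)"

text \<open>Left unnormalised: the local density of \<open>S\<close> is this divided by
  \<open>(2 * r) ^ CARD('n)\<close>.\<close>

definition cube_part :: "real \<Rightarrow> (real ^ 'n) set \<Rightarrow> real ^ 'n \<Rightarrow> real" where
  "cube_part r S x = measure lborel (S \<inter> cube r x)"

lemma mem_cube: "y \<in> cube r x \<longleftrightarrow> (\<forall>i. \<bar>y $ i - x $ i\<bar> \<le> r)"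
  by (auto simp: cube_def mem_box_cart abs_le_iff) (smt (verit, best))+

lemma mem_cube_sym: "y \<in> cube r x \<longleftrightarrow> x \<in> cube r y"
  by (simp add: mem_cube abs_minus_commute)

lemma borel_cube [measurable]: "cube r x \<in> sets borel"
  by (simp add: cube_def)

lemma measure_cube:
  fixes x :: "real ^ 'n"
  assumes "0 \<le> r"
  shows "measure lborel (cube r x) = (2 * r) ^ CARD('n)"
proof -
  have "cube r x \<noteq> {}" using assms mem_cube[of x r x] by auto
  then show ?thesis unfolding cube_def by (subst content_cbox_cart) auto
qed

lemma cube_fmeasurable: "S \<in> sets borel \<Longrightarrow> S \<inter> cube r x \<in> fmeasurable lborel"
  by (rule fmeasurableI) (auto simp: cube_def intro!: le_less_trans[OF emeasure_mono emeasure_lborel_cbox_finite[unfolded infinity_ennreal_def]])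

lemma norm_le_cube:
  fixes x :: "real ^ 'n"
  assumes "y \<in> cube r x"
  shows "norm (y - x) \<le> sqrt CARD('n) * r"
proof -
  have "infnorm (y - x) \<le> r"
    unfolding infnorm_Max using assms by (auto simp: mem_cube Basis_vec_def inner_axis)
  then have "sqrt CARD('n) * infnorm (y - x) \<le> sqrt CARD('n) * r" by (intro mult_left_mono) auto
  moreover have "norm (y - x) \<le> sqrt CARD('n) * infnorm (y - x)"
    using norm_le_infnorm[of "y - x"] by simp
  ultimately show ?thesis by linarith
qed

text \<open>The overlap is a box with sides 2 r - |x_i - y_i|, and a product of factors 1 - a_i with
  a_i in [0, 1] is at least 1 minus the sum of the a_i. If some coordinate differs by more than 2 r,
  the left side is not positive.\<close>

lemma cube_overlap:
  fixes x y :: "real ^ 'n"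
  assumes r: "0 < r"
  shows "(2 * r) ^ CARD('n) * (1 - (\<Sum>i\<in>UNIV. \<bar>x $ i - y $ i\<bar>) / (2 * r)) \<le> measure lborel (cube r x \<inter> cube r y)"
proof (cases "\<forall>i. \<bar>x $ i - y $ i\<bar> \<le> 2 * r")
  case True
  let ?a = "(\<chi> i. max (x $ i) (y $ i)) - vec r" and ?b = "(\<chi> i. min (x $ i) (y $ i)) + vec r"
  have "(max p q - r \<le> z \<and> z \<le> min p q + r) \<longleftrightarrow> \<bar>z - p\<bar> \<le> r \<and> \<bar>z - q\<bar> \<le> r" for p q z :: real
    by (auto simp: max_def min_def abs_le_iff)
  then have inter: "cube r x \<inter> cube r y = cbox ?a ?b"
    by (simp add: set_eq_iff mem_cube mem_box_cart all_conj_distrib)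
  have ba: "?b $ i - ?a $ i = 2 * r * (1 - \<bar>x $ i - y $ i\<bar> / (2 * r))" for i
    using r by (simp add: field_simps max_def min_def abs_if)
  have nonneg: "0 \<le> ?b $ i - ?a $ i" for i
    unfolding ba using True r by (intro mult_nonneg_nonneg) (auto simp: field_simps)
  have "?a $ i \<le> ?b $ i" for i using nonneg[of i] by linarith
  then have "cbox ?a ?b \<noteq> {}" unfolding interval_ne_empty_cart by blast
  then have "measure lborel (cube r x \<inter> cube r y) = (\<Prod>i\<in>UNIV. ?b $ i - ?a $ i)"
    unfolding inter by (rule content_cbox_cart)
  also have "\<dots> = (\<Prod>i\<in>UNIV. 2 * r * (1 - \<bar>x $ i - y $ i\<bar> / (2 * r)))"
    by (simp only: ba)
  also have "\<dots> = (2 * r) ^ CARD('n) * (\<Prod>i\<in>UNIV. 1 - \<bar>x $ i - y $ i\<bar> / (2 * r))"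
    unfolding prod.distrib by simp
  finally have eq: "measure lborel (cube r x \<inter> cube r y)
    = (2 * r) ^ CARD('n) * (\<Prod>i\<in>UNIV. 1 - \<bar>x $ i - y $ i\<bar> / (2 * r))" .
  have "1 - (\<Sum>i\<in>UNIV. \<bar>x $ i - y $ i\<bar> / (2 * r)) \<le> (\<Prod>i\<in>UNIV. 1 - \<bar>x $ i - y $ i\<bar> / (2 * r))"
    using True r by (intro Weierstrass_prod_ineq) simp
  then show ?thesis
    unfolding eq sum_divide_distrib using r by (intro mult_left_mono) simp_all
next
  case False
  then obtain j where "2 * r < \<bar>x $ j - y $ j\<bar>" by (auto simp: not_le)
  also have "\<dots> \<le> (\<Sum>i\<in>UNIV. \<bar>x $ i - y $ i\<bar>)" by (rule member_le_sum) auto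
  finally have "1 - (\<Sum>i\<in>UNIV. \<bar>x $ i - y $ i\<bar>) / (2 * r) \<le> 0" using r by simp
  then have "(2 * r) ^ CARD('n) * (1 - (\<Sum>i\<in>UNIV. \<bar>x $ i - y $ i\<bar>) / (2 * r)) \<le> 0"
    using r by (simp add: mult_le_0_iff)
  then show ?thesis by (meson measure_nonneg order_trans)
qed

text \<open>Only the part of one cube outside the other can contribute to the difference. After
  normalising, the density is Lipschitz with constant 1 / (2 r) for the sum norm.\<close>

lemma cube_part_diff:
  fixes x y :: "real ^ 'n"
  assumes r: "0 < r" and S: "S \<in> sets borel"
  shows "\<bar>cube_part r S x - cube_part r S y\<bar> \<le> (2 * r) ^ CARD('n) * ((\<Sum>i\<in>UNIV. \<bar>x $ i - y $ i\<bar>) / (2 * r))"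
proof -
  have le: "cube_part r S x \<le> cube_part r S y + (2 * r) ^ CARD('n) * ((\<Sum>i\<in>UNIV. \<bar>x $ i - y $ i\<bar>) / (2 * r))"
    for x y :: "real ^ 'n"
  proof -
    have fm: "cube r x \<in> fmeasurable lborel" for x :: "real ^ 'n" using cube_fmeasurable[of UNIV r x] by simp
    have "cube_part r S x \<le> measure lborel ((S \<inter> cube r y) \<union> (cube r x - cube r y))"
      unfolding cube_part_def using S fm
      by (intro measure_mono_fmeasurable fmeasurable.Un cube_fmeasurable fmeasurable.Diff) auto
    also have "\<dots> \<le> cube_part r S y + measure lborel (cube r x - cube r y)"
      unfolding cube_part_def using S by (intro measure_Un_le) auto
    also have "measure lborel (cube r x - cube r y) = measure lborel (cube r x) - measure lborel (cube r x \<inter> cube r y)"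
    proof -
      have "cube r x - cube r y = cube r x - (cube r x \<inter> cube r y)" by auto
      then show ?thesis using fm by (simp add: measure_Diff fmeasurable_def less_top)
    qed
    also have "\<dots> \<le> (2 * r) ^ CARD('n) * ((\<Sum>i\<in>UNIV. \<bar>x $ i - y $ i\<bar>) / (2 * r))"
      using cube_overlap[OF r, of x y] r by (simp add: measure_cube algebra_simps)
    finally show ?thesis by simp
  qed
  show ?thesis using le[of x y] le[of y x] by (simp add: abs_le_iff abs_minus_commute)
qed

lemma sum_abs_le_norm: "(\<Sum>i\<in>UNIV. \<bar>x $ i\<bar>) \<le> real CARD('n) * norm (x :: real ^ 'n)"
  using sum_bounded_above[of UNIV "\<lambda>i. \<bar>x $ i\<bar>" "norm x"] by (simp add: component_le_norm_cart)

lemma continuous_cube_part: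
  fixes S :: "(real ^ 'n) set"
  assumes r: "0 < r" and S: "S \<in> sets borel"
  shows "continuous_on X (cube_part r S)"
proof -
  let ?M = "(2 * r) ^ CARD('n) * (real CARD('n) / (2 * r))"
  have "?M-lipschitz_on X (cube_part r S)"
  proof (rule lipschitz_onI)
    fix x y :: "real ^ 'n"
    have "\<bar>cube_part r S x - cube_part r S y\<bar> \<le> (2 * r) ^ CARD('n) * ((\<Sum>i\<in>UNIV. \<bar>x $ i - y $ i\<bar>) / (2 * r))"
      by (rule cube_part_diff[OF r S])
    also have "\<dots> \<le> (2 * r) ^ CARD('n) * (real CARD('n) * norm (x - y) / (2 * r))"
      using r sum_abs_le_norm[of "x - y"] by (intro mult_left_mono divide_right_mono) auto
    finally show "dist (cube_part r S x) (cube_part r S y) \<le> ?M * dist x y"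
      by (simp add: dist_norm)
  qed (use r in simp)
  then show ?thesis by (rule lipschitz_on_continuous_on)
qed

lemma cube_part_bounds:
  fixes x :: "real ^ 'n"
  assumes "0 \<le> r" "S \<in> sets borel"
  shows "0 \<le> cube_part r S x" "cube_part r S x \<le> (2 * r) ^ CARD('n)"
proof -
  show "0 \<le> cube_part r S x" by (simp add: cube_part_def)
  have "cube_part r S x \<le> measure lborel (cube r x)"
    unfolding cube_part_def using assms cube_fmeasurable[of UNIV r x] by (intro measure_mono_fmeasurable) auto
  then show "cube_part r S x \<le> (2 * r) ^ CARD('n)" using assms by (simp add: measure_cube)
qed

section \<open>Double counting: integrals of local volumes\<close>

lemma closed_cube_graph: "closed {p :: (real ^ 'n) \<times> (real ^ 'n). snd p \<in> cube r (fst p)}"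
  unfolding mem_cube
  by (intro closed_Collect_all closed_Collect_le continuous_intros)

text \<open>Tonelli for the set of pairs (x, y) with x in \<open>L\<close>, y in \<open>S\<close>
  and y in the cube about x; being in each other's cube is symmetric.\<close>

lemma cube_part_swap:
  fixes L S :: "(real ^ 'n) set"
  assumes [measurable]: "L \<in> sets borel" "S \<in> sets borel"
  shows "(\<integral>\<^sup>+x. indicator L x * ennreal (cube_part r S x) \<partial>lborel)
    = (\<integral>\<^sup>+y. indicator S y * ennreal (cube_part r L y) \<partial>lborel)"
proof -
  define E where "E = {p :: (real ^ 'n) \<times> (real ^ 'n). snd p \<in> cube r (fst p)} \<inter> (L \<times> S)"
  have "L \<times> S \<in> sets borel" by (subst borel_prod[symmetric]) (rule pair_measureI; measurable)
  then have "E \<in> sets borel" unfolding E_def by (intro sets.Int borel_closed[OF closed_cube_graph])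
  then have E: "E \<in> sets (lborel \<Otimes>\<^sub>M lborel)" unfolding lborel_prod by simp
  have em: "emeasure lborel (T \<inter> cube r x) = ennreal (cube_part r T x)" if "T \<in> sets borel" for T and x :: "real ^ 'n"
    unfolding cube_part_def using cube_fmeasurable[OF that, of r x] by (simp add: emeasure_eq_measure2)
  have "Pair x -` E = (if x \<in> L then S \<inter> cube r x else {})" for x by (auto simp: E_def)
  then have "emeasure (lborel \<Otimes>\<^sub>M lborel) E = (\<integral>\<^sup>+x. indicator L x * ennreal (cube_part r S x) \<partial>lborel)"
    using E by (subst lborel.emeasure_pair_measure_alt) (auto simp: em intro!: nn_integral_cong split: split_indicator)
  moreover have "(\<lambda>x. (x, y)) -` E = (if y \<in> S then L \<inter> cube r y else {})" for y
    by (auto simp: E_def mem_cube_sym)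
  then have "emeasure (lborel \<Otimes>\<^sub>M lborel) E = (\<integral>\<^sup>+y. indicator S y * ennreal (cube_part r L y) \<partial>lborel)"
    using E by (subst lborel_pair.emeasure_pair_measure_alt2) (auto simp: em intro!: nn_integral_cong split: split_indicator)
  ultimately show ?thesis by simp
qed

lemma integrable_cube_part:
  fixes L :: "(real ^ 'n) set"
  assumes "0 < r" "compact L" "S \<in> sets borel"
  shows "integrable lborel (\<lambda>x. indicator L x * cube_part r S x)"
  using borel_integrable_compact[OF assms(2) continuous_cube_part[OF assms(1,3)]]
  by (simp add: indicator_scaleR_eq_if indicator_def if_distrib cong: if_cong)

lemma integral_cube_part:
  fixes L :: "(real ^ 'n) set"
  assumes r: "0 < r" and L: "compact L" and S [measurable]: "S \<in> sets borel"
  shows "ennreal (\<integral>x. indicator L x * cube_part r S x \<partial>lborel)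
    = (\<integral>\<^sup>+y. indicator S y * ennreal (cube_part r L y) \<partial>lborel)"
proof -
  have "ennreal (\<integral>x. indicator L x * cube_part r S x \<partial>lborel)
      = (\<integral>\<^sup>+x. ennreal (indicator L x * cube_part r S x) \<partial>lborel)"
    using integrable_cube_part[OF r L S] cube_part_bounds(1)[of r S] r
    by (intro nn_integral_eq_integral[symmetric]) auto
  also have "\<dots> = (\<integral>\<^sup>+x. indicator L x * ennreal (cube_part r S x) \<partial>lborel)"
    by (intro nn_integral_cong) (simp split: split_indicator)
  also have "\<dots> = (\<integral>\<^sup>+y. indicator S y * ennreal (cube_part r L y) \<partial>lborel)"
    using L by (intro cube_part_swap) (auto intro: borel_compact)
  finally show ?thesis .
qed

lemma integral_cube_part_le:
  fixes L :: "(real ^ 'n) set"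
  assumes r: "0 < r" and L: "compact L" and S [measurable]: "S \<in> sets borel" and fin: "emeasure lborel S < \<infinity>"
  shows "(\<integral>x. indicator L x * cube_part r S x \<partial>lborel) \<le> (2 * r) ^ CARD('n) * measure lborel S"
proof -
  have le: "ennreal (cube_part r L y) \<le> ennreal ((2 * r) ^ CARD('n))" for y
    using r L by (intro ennreal_leI cube_part_bounds) (auto intro: borel_compact)
  have "ennreal (\<integral>x. indicator L x * cube_part r S x \<partial>lborel)
      \<le> (\<integral>\<^sup>+y. ennreal ((2 * r) ^ CARD('n)) * indicator S y \<partial>lborel)"
    unfolding integral_cube_part[OF r L S]
    by (intro nn_integral_mono) (use le in \<open>simp split: split_indicator\<close>)
  also have "\<dots> = ennreal ((2 * r) ^ CARD('n) * measure lborel S)"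
    using r fin by (simp add: nn_integral_cmult_indicator emeasure_eq_ennreal_measure less_top ennreal_mult)
  finally show ?thesis using r by (subst (asm) ennreal_le_iff) auto
qed

text \<open>After the exchange of integrals each y in \<open>S\<close> is weighted by the part of
  its cube in \<open>L\<close>. For y in \<open>L'\<close> this is the whole cube; points near the
  boundary are the loss.\<close>

lemma integral_cube_part_ge:
  fixes L :: "(real ^ 'n) set"
  assumes r: "0 < r" and L: "compact L" and S [measurable]: "S \<in> sets borel"
    and L' [measurable]: "L' \<in> sets borel" and fin: "emeasure lborel (S \<inter> L') < \<infinity>"
    and sub: "\<And>y. y \<in> L' \<Longrightarrow> cube r y \<subseteq> L"
  shows "(2 * r) ^ CARD('n) * measure lborel (S \<inter> L') \<le> (\<integral>x. indicator L x * cube_part r S x \<partial>lborel)"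
proof -
  have full: "cube_part r L y = (2 * r) ^ CARD('n)" if "y \<in> L'" for y
    using sub[OF that] r by (simp add: cube_part_def Int_absorb1 measure_cube)
  have "ennreal ((2 * r) ^ CARD('n) * measure lborel (S \<inter> L'))
      = (\<integral>\<^sup>+y. ennreal ((2 * r) ^ CARD('n)) * indicator (S \<inter> L') y \<partial>lborel)"
    using r fin by (simp add: nn_integral_cmult_indicator emeasure_eq_ennreal_measure less_top ennreal_mult)
  also have "\<dots> \<le> ennreal (\<integral>x. indicator L x * cube_part r S x \<partial>lborel)"
    unfolding integral_cube_part[OF r L S]
    by (intro nn_integral_mono) (auto split: split_indicator simp: full)
  finally show ?thesis
    using cube_part_bounds(1)[of r S] r by (subst (asm) ennreal_le_iff) (auto intro!: integral_nonneg_AE)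
qed

text \<open>The pointwise bound F1 (N - F1) \<le> n F3 N is used three times. Off \<open>A\<close>
  the second factor is at least N / 4, so F1 \<le> 4 n F3; off \<open>B\<close> the first one is, so
  F2 \<le> 4 n F3; off both sets the product is at least 3/16 N^2, so N \<le> 16/3 n F3. Integration
  over \<open>L\<close> turns these into the volume bounds.\<close>

lemma axis_disjoint_partition:
  fixes L L' S1 S2 S3 :: "(real ^ 'n) set"
  defines "n \<equiv> real CARD('n)"
  assumes r: "0 < r" and L: "compact L" and L': "L' \<in> sets borel"
    and S [measurable]: "S1 \<in> sets borel" "S2 \<in> sets borel" "S3 \<in> sets borel"
    and bdd: "bounded S1" "bounded S2" "bounded S3"
    and disj: "S1 \<inter> S2 = {}" "S1 \<inter> S3 = {}" "S2 \<inter> S3 = {}"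
    and cover: "\<And>x. x \<in> L \<Longrightarrow> cube r x \<subseteq> S1 \<union> S2 \<union> S3"
    and sub: "\<And>y. y \<in> L' \<Longrightarrow> cube r y \<subseteq> L"
    and axis: "axis_disjoint S1 S2"
  obtains A B where "compact A" "compact B" "A \<subseteq> L" "B \<subseteq> L"
    "\<And>x y. x \<in> A \<Longrightarrow> y \<in> B \<Longrightarrow> 2 * r / (3 * n) < norm (x - y)"
    "measure lborel (S1 \<inter> L') \<le> measure lborel A + 4 * n * measure lborel S3"
    "measure lborel (S2 \<inter> L') \<le> measure lborel B + 4 * n * measure lborel S3"
    "measure lborel (L - (A \<union> B)) \<le> 16 / 3 * n * measure lborel S3"
proof -
  define N where "N = (2 * r) ^ CARD('n)"
  have N: "0 < N" using r by (simp add: N_def)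
  have n: "1 \<le> n" by (simp add: n_def Suc_leI)
  let ?F1 = "cube_part r S1" and ?F2 = "cube_part r S2" and ?F3 = "cube_part r S3"
  have nonneg: "0 \<le> ?F1 x" "0 \<le> ?F2 x" "0 \<le> ?F3 x" for x
    using r S by (auto intro!: cube_part_bounds)
  have le_N: "?F1 x \<le> N" "?F2 x \<le> N" for x
    unfolding N_def by (intro cube_part_bounds less_imp_le[OF r] S)+
  have total: "?F1 x + ?F2 x + ?F3 x = N" if "x \<in> L" for x
  proof -
    have fm: "S \<inter> cube r x \<in> fmeasurable lborel" if "S \<in> sets borel" for S
      using that by (rule cube_fmeasurable)
    have "cube r x = (S1 \<inter> cube r x) \<union> ((S2 \<inter> cube r x) \<union> (S3 \<inter> cube r x))"
      using cover[OF that] by auto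
    then have "N = measure lborel ((S1 \<inter> cube r x) \<union> ((S2 \<inter> cube r x) \<union> (S3 \<inter> cube r x)))"
      unfolding N_def using measure_cube[of r x] r by simp
    also have "\<dots> = ?F1 x + measure lborel ((S2 \<inter> cube r x) \<union> (S3 \<inter> cube r x))"
      unfolding cube_part_def using disj fm S
      by (subst measure_Un3) (auto simp: fmeasurable.Un Int_Un_distrib disjoint_iff intro!: arg_cong[where f = "measure lborel" and y = "{}", simplified])
    also have "measure lborel ((S2 \<inter> cube r x) \<union> (S3 \<inter> cube r x)) = ?F2 x + ?F3 x"
      unfolding cube_part_def using disj fm S
      by (subst measure_Un3) (auto simp: disjoint_iff intro!: arg_cong[where f = "measure lborel" and y = "{}", simplified])
    finally show ?thesis by simp
  qed
  \<comment> \<open>The exchange argument gives n - 1 for F1 F2; the last unit pays for F1 F3, since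
    N - F1 = F2 + F3.\<close>
  have key: "?F1 x * (N - ?F1 x) \<le> n * ?F3 x * N" if x: "x \<in> L" for x
  proof -
    have "?F1 x * ?F2 x \<le> (n - 1) * (?F3 x * N)"
      using axis_disjoint_box[OF S axis cover[OF x, unfolded cube_def]] measure_cube[of r x] r
      by (simp only: cube_part_def n_def cube_def N_def less_imp_le)
    moreover have "?F1 x * ?F3 x \<le> N * ?F3 x" using le_N nonneg by (intro mult_right_mono)
    moreover have "N - ?F1 x = ?F2 x + ?F3 x" using total[OF x] by simp
    ultimately show ?thesis by (simp add: algebra_simps)
  qed
  define A B where "A = {x \<in> L. 3 / 4 * N \<le> ?F1 x}" and "B = {x \<in> L. ?F1 x \<le> N / 4}"
  have off_A: "?F1 x \<le> 4 * n * ?F3 x" if x: "x \<in> L" "x \<notin> A" for x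
  proof -
    have "?F1 x * (N / 4) \<le> ?F1 x * (N - ?F1 x)"
      using x nonneg by (intro mult_left_mono) (auto simp: A_def)
    then have "?F1 x * N \<le> 4 * n * ?F3 x * N" using key[OF x(1)] by simp
    then show ?thesis using N by simp
  qed
  have off_B: "?F2 x \<le> 4 * n * ?F3 x" if x: "x \<in> L" "x \<notin> B" for x
  proof -
    have "(N / 4) * (N - ?F1 x) \<le> ?F1 x * (N - ?F1 x)"
      using x le_N by (intro mult_right_mono) (auto simp: B_def)
    then have "(N - ?F1 x) * N \<le> 4 * n * ?F3 x * N" using key[OF x(1)] by (simp add: mult_ac)
    then have "N - ?F1 x \<le> 4 * n * ?F3 x" using N by simp
    then show ?thesis using total[OF x(1)] nonneg(3)[of x] by linarith
  qed
  have off_AB: "N \<le> 16 / 3 * n * ?F3 x" if x: "x \<in> L" "x \<notin> A" "x \<notin> B" for x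
  proof -
    have "0 \<le> (?F1 x - N / 4) * (3 / 4 * N - ?F1 x)"
      using x by (intro mult_nonneg_nonneg) (auto simp: A_def B_def)
    then have "3 / 16 * N * N \<le> ?F1 x * (N - ?F1 x)" by (simp add: algebra_simps)
    then have "3 / 16 * N * N \<le> n * ?F3 x * N" using key[OF x(1)] by linarith
    then have "3 / 16 * N \<le> n * ?F3 x" using N by simp
    then show ?thesis by simp
  qed
  have cont: "continuous_on L ?F1" by (rule continuous_cube_part[OF r S(1)])
  have cA: "compact A"
  proof -
    have "A = L \<inter> ?F1 -` {3 / 4 * N..}" by (auto simp: A_def)
    then show ?thesis using continuous_on_closed_vimage[OF compact_imp_closed[OF L]] cont L
      by (metis closed_atLeast Int_commute compact_Int_closed inf.idem inf_assoc)
  qed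
  have cB: "compact B"
  proof -
    have "B = L \<inter> ?F1 -` {..N / 4}" by (auto simp: B_def)
    then show ?thesis using continuous_on_closed_vimage[OF compact_imp_closed[OF L]] cont L
      by (metis closed_atMost Int_commute compact_Int_closed inf.idem inf_assoc)
  qed
  have dist: "2 * r / (3 * n) < norm (x - y)" if "x \<in> A" "y \<in> B" for x y
  proof -
    have "3 / 4 * N \<le> ?F1 x" "?F1 y \<le> N / 4" using that by (auto simp: A_def B_def)
    then have "N * (1 / 2) \<le> \<bar>?F1 x - ?F1 y\<bar>" by linarith
    also have "\<dots> \<le> N * ((\<Sum>i\<in>UNIV. \<bar>x $ i - y $ i\<bar>) / (2 * r))"
      unfolding N_def by (rule cube_part_diff[OF r S(1)])
    finally have "1 / 2 \<le> (\<Sum>i\<in>UNIV. \<bar>x $ i - y $ i\<bar>) / (2 * r)" using N by (simp only: mult_le_cancel_left_pos)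
    then have "r \<le> (\<Sum>i\<in>UNIV. \<bar>x $ i - y $ i\<bar>)" using r by (simp add: field_simps)
    also have "\<dots> \<le> n * norm (x - y)" using sum_abs_le_norm[of "x - y"] by (simp add: n_def)
    finally have "r / n \<le> norm (x - y)" using n by (simp add: divide_le_eq mult.commute)
    \<comment> \<open>A density drop of 1/2 forces distance at least r / n; the factor 2/3 makes the
      separation strict, as the isoperimetric inequality asks.\<close>
    moreover have "2 * r / (3 * n) < r / n" using r n by (simp add: field_simps)
    ultimately show ?thesis by linarith
  qed
  have fin: "emeasure lborel S < \<infinity>" if "bounded S" for S :: "(real ^ 'n) set"
    using emeasure_bounded_finite[OF that] by simp
  define I where "I S = (\<integral>x. indicator L x * cube_part r S x \<partial>lborel)" for S
  have int: "integrable lborel (\<lambda>x. indicator L x * cube_part r S x)" if "S \<in> sets borel" for S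
    by (rule integrable_cube_part[OF r L that])
  have bA: "A \<in> sets borel" "B \<in> sets borel" "L \<in> sets borel" using cA cB L by (auto intro: borel_compact)
  have AL: "A \<subseteq> L" "B \<subseteq> L" by (auto simp: A_def B_def)
  have ind: "integrable lborel (\<lambda>x. indicator T x * (c::real))" "(\<integral>x. indicator T x * c \<partial>lborel) = c * measure lborel T"
    if "T \<in> sets borel" "T \<subseteq> L" for T c
    using that fin[OF bounded_subset[OF compact_imp_bounded[OF L] that(2)]]
    by (auto intro!: integrable_mult_left integrable_real_indicator)
  have I3: "I S3 \<le> N * measure lborel S3"
    unfolding I_def N_def by (rule integral_cube_part_le[OF r L S(3) fin[OF bdd(3)]])
  have I_ge: "N * measure lborel (S \<inter> L') \<le> I S" if "S \<in> sets borel" "bounded S" for S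
    unfolding I_def N_def using that
    by (intro integral_cube_part_ge[OF r L _ L' _ sub] fin) (auto intro: bounded_subset)
  have bound: "I S \<le> N * measure lborel T + 4 * n * I S3"
    if "S \<in> sets borel" "T \<in> sets borel" "T \<subseteq> L" "\<And>x. cube_part r S x \<le> N"
      "\<And>x. x \<in> L \<Longrightarrow> x \<notin> T \<Longrightarrow> cube_part r S x \<le> 4 * n * ?F3 x" for S T
  proof -
    \<comment> \<open>Pointwise, the local volume is at most N on \<open>T\<close> and is controlled
      by \<open>S3\<close> on the rest of \<open>L\<close>.\<close>
    have "I S \<le> (\<integral>x. indicator T x * N + 4 * n * (indicator L x * ?F3 x) \<partial>lborel)"
      unfolding I_def
    proof (intro Bochner_Integration.integral_mono Bochner_Integration.integrable_add ind int integrable_mult_right that(1-3) S)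
      fix x
      show "indicator L x * cube_part r S x \<le> indicator T x * N + 4 * n * (indicator L x * ?F3 x)"
        using that(3-5) nonneg(3)[of x] n that(4)[of x]
        by (cases "x \<in> L"; cases "x \<in> T") (auto intro: add_increasing2)
    qed
    also have "\<dots> = N * measure lborel T + 4 * n * I S3"
      using ind[OF that(2,3)] int[OF S(3)] by (simp add: I_def mult.commute)
    finally show ?thesis .
  qed
  have meas: "measure lborel (S \<inter> L') \<le> measure lborel T + 4 * n * measure lborel S3"
    if "S \<in> sets borel" "bounded S" "I S \<le> N * measure lborel T + 4 * n * I S3" for S T
  proof -
    have "4 * n * I S3 \<le> 4 * n * (N * measure lborel S3)" using I3 n by (intro mult_left_mono) auto
    then have "N * measure lborel (S \<inter> L') \<le> N * (measure lborel T + 4 * n * measure lborel S3)"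
      using I_ge[OF that(1,2)] that(3) by (simp add: algebra_simps)
    then show ?thesis using N by simp
  qed
  have "measure lborel (L - (A \<union> B)) \<le> 16 / 3 * n * measure lborel S3"
  proof -
    have LAB: "L - (A \<union> B) \<in> sets borel" "L - (A \<union> B) \<subseteq> L" using bA by auto
    have "(\<integral>x. indicator (L - (A \<union> B)) x * N \<partial>lborel) \<le> (\<integral>x. 16 / 3 * n * (indicator L x * ?F3 x) \<partial>lborel)"
    proof (intro Bochner_Integration.integral_mono ind LAB integrable_mult_right int S)
      fix x
      show "indicator (L - (A \<union> B)) x * N \<le> 16 / 3 * n * (indicator L x * ?F3 x)"
        using off_AB[of x] nonneg(3)[of x] n by (auto split: split_indicator)
    qed
    also have "\<dots> = 16 / 3 * n * I S3" by (simp add: I_def)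
    also have "\<dots> \<le> 16 / 3 * n * (N * measure lborel S3)" using I3 n by (intro mult_left_mono) auto
    finally have "N * measure lborel (L - (A \<union> B)) \<le> N * (16 / 3 * n * measure lborel S3)"
      using ind(2)[OF LAB] by (simp add: algebra_simps)
    then show ?thesis using N by (simp only: mult_le_cancel_left_pos)
  qed
  then show thesis
    using that cA cB AL dist
      meas[OF S(1) bdd(1) bound[OF S(1) bA(1) AL(1) le_N(1) off_A]]
      meas[OF S(2) bdd(2) bound[OF S(2) bA(2) AL(2) le_N(2) off_B]] by blast
qed

section \<open>Second moments and homothetic copies\<close>

lemma vol_borel: "S \<in> sets borel \<Longrightarrow> vol S = measure lborel S"
  by (simp add: measure_completion)

text \<open>Markov's inequality for the squared distance, which is bounded on the compact
  \<open>K\<close> and hence integrable.\<close>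

lemma second_moment_tail:
  fixes K :: "'a::euclidean_space set"
  assumes K: "compact K" "0 < vol K" and s: "0 < s"
  shows "vol {x \<in> K. s \<le> norm (x - z)} \<le> uniform_expectation K (\<lambda>x. (norm (x - z))\<^sup>2) / s\<^sup>2 * vol K"
proof -
  let ?P = "uniform_measure lebesgue K" and ?f = "\<lambda>x. (norm (x - z))\<^sup>2"
  have Km: "K \<in> lmeasurable" using K(1) by (rule lmeasurable_compact)
  have em: "emeasure lebesgue K \<noteq> 0" "emeasure lebesgue K < \<infinity>"
    using K(2) by (simp_all add: emeasure_eq_measure2[OF Km])
  interpret P: prob_space ?P using em by (intro prob_space_uniform_measure) auto
  have mf: "?f \<in> borel_measurable lebesgue"
    by (intro measurable_completion) measurable
  obtain b where b: "\<And>x. x \<in> K \<Longrightarrow> ?f x \<le> b"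
  proof -
    have "compact (?f ` K)" using K(1) by (intro compact_continuous_image continuous_intros)
    then have "bdd_above (?f ` K)" by (simp add: bounded_imp_bdd_above compact_imp_bounded)
    then show thesis using that by (auto simp: bdd_above_def)
  qed
  have "AE x in ?P. norm (?f x) \<le> b"
    using Km b by (intro AE_uniform_measureI) (auto simp: fmeasurableD)
  then have int: "integrable ?P ?f"
    using mf by (intro P.integrable_const_bound) (auto simp: measurable_cong_sets[OF sets_uniform_measure refl])
  have "P.prob {x \<in> space ?P. s\<^sup>2 \<le> ?f x} \<le> (\<integral>x. ?f x \<partial>?P) / s\<^sup>2"
    using s by (intro integral_Markov_inequality_measure[OF int, of "{}"]) auto
  moreover have "P.prob {x \<in> space ?P. s\<^sup>2 \<le> ?f x} = vol (K \<inter> {x. s\<^sup>2 \<le> ?f x}) / vol K"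
  proof -
    have "closed {x. s\<^sup>2 \<le> ?f x}" by (intro closed_Collect_le continuous_intros)
    then have "{x. s\<^sup>2 \<le> ?f x} \<in> sets lebesgue" by (simp add: borel_closed)
    from measure_uniform_measure[OF em(1) _ this] show ?thesis using em(2) by simp
  qed
  moreover have "K \<inter> {x. s\<^sup>2 \<le> ?f x} = {x \<in> K. s \<le> norm (x - z)}" using s by (auto simp: power_mono_iff)
  ultimately have "vol {x \<in> K. s \<le> norm (x - z)} / vol K \<le> (\<integral>x. ?f x \<partial>?P) / s\<^sup>2" by simp
  then show ?thesis using K(2) by (simp add: pos_divide_le_eq)
qed

text \<open>A ball of radius sqrt (1/2) has at most half the volume of the unit ball when the
  dimension is at least 2. So at least half of \<open>K\<close> has squared distance at least 1/2
  from \<open>z\<close>.\<close>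

lemma second_moment_ge:
  fixes K :: "'a::euclidean_space set"
  assumes K: "compact K" "cball c 1 \<subseteq> K" and dim: "2 \<le> DIM('a)"
  shows "1 / 4 \<le> uniform_expectation K (\<lambda>x. (norm (x - z))\<^sup>2)"
proof -
  have "measure lborel (cball c 1) \<le> vol K"
    using K measure_mono_fmeasurable[of "cball c 1" K lebesgue] by (auto simp: lmeasurable_compact)
  moreover have "0 < measure lborel (cball c (1::real))" by (simp add: content_cball_pos)
  ultimately have V: "0 < vol K" by linarith
  define s where "s = sqrt (1 / 2)"
  have s: "0 < s" "s\<^sup>2 = 1 / 2" "s \<le> 1" by (auto simp: s_def)
  let ?D = "{x \<in> K. s \<le> norm (x - z)}"
  have cD: "compact ?D" using K(1) by (rule compact_outside_ball)
  have "vol K \<le> vol (ball z s \<union> ?D)"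
  proof (rule measure_mono_fmeasurable)
    show "K \<subseteq> ball z s \<union> ?D" by (auto simp: dist_norm norm_minus_commute)
    show "K \<in> sets lebesgue" using K(1) by (simp add: lmeasurable_compact fmeasurableD)
    show "ball z s \<union> ?D \<in> lmeasurable" by (intro fmeasurable.Un lmeasurable_ball lmeasurable_compact cD)
  qed
  also have "\<dots> \<le> vol (ball z s) + vol ?D"
    using cD by (intro measure_Un_le) (auto simp: lmeasurable_compact fmeasurableD)
  also have "vol (ball z s) \<le> 1 / 2 * vol K"
  proof -
    have "measure lborel (ball z s) = s ^ DIM('a) * measure lborel (ball (0::'a) 1)"
      using s by (intro content_ball_conv_unit_ball) simp
    moreover have "measure lborel (ball c 1) = measure lborel (ball (0::'a) 1)"
      using content_ball_conv_unit_ball[of 1 c] by simp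
    moreover have "s ^ DIM('a) \<le> s ^ 2" using s dim by (intro power_decreasing) auto
    moreover have "measure lborel (ball c 1) \<le> vol K"
      using K(1) measure_mono_fmeasurable[OF order_trans[OF ball_subset_cball K(2)], of lebesgue]
      by (simp add: lmeasurable_compact)
    ultimately have "measure lborel (ball z s) \<le> 1 / 2 * vol K"
      using s mult_mono[of "s ^ DIM('a)" "1 / 2" "measure lborel (ball (0::'a) 1)" "vol K"] by simp
    then show ?thesis by simp
  qed
  also have "vol ?D \<le> uniform_expectation K (\<lambda>x. (norm (x - z))\<^sup>2) / s\<^sup>2 * vol K"
    by (rule second_moment_tail[OF K(1) V s(1)])
  finally have "vol K * 1 \<le> vol K * (1 / 2 + 2 * uniform_expectation K (\<lambda>x. (norm (x - z))\<^sup>2))"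
    using s by (simp add: algebra_simps)
  then show ?thesis using V by (simp only: mult_le_cancel_left_pos)
qed

section \<open>Homothetic copies and the margin they leave\<close>

definition shrink :: "real \<Rightarrow> 'a::euclidean_space \<Rightarrow> 'a set \<Rightarrow> 'a set" where
  "shrink \<eta> c K = (\<lambda>x. (1 - \<eta>) *\<^sub>R x + \<eta> *\<^sub>R c) ` K"

lemma vol_shrink: "\<eta> \<le> 1 \<Longrightarrow> vol (shrink \<eta> c K) = (1 - \<eta>) ^ DIM('a) * vol (K :: 'a::euclidean_space set)"
  unfolding shrink_def by (subst measure_lebesgue_affine) simp

lemma convex_shrink: "convex K \<Longrightarrow> convex (shrink \<eta> c K)"
  using convex_affinity[of K "\<eta> *\<^sub>R c" "1 - \<eta>"] by (simp add: shrink_def add.commute)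

lemma compact_shrink: "compact K \<Longrightarrow> compact (shrink \<eta> c K)"
  unfolding shrink_def by (intro compact_continuous_image continuous_intros)

text \<open>The unit ball about \<open>c\<close> turns a contraction by \<eta> into a Euclidean
  margin \<eta>. The parameter \<zeta> allows two nested margins: one between \<open>K\<close> and
  the domain of averaging, one inside that domain.\<close>

lemma shrink_nbhd:
  assumes K: "convex K" "cball c 1 \<subseteq> K" and \<eta>: "0 \<le> \<zeta>" "0 < \<eta>" "\<zeta> + \<eta> \<le> 1"
    and x: "x \<in> shrink (\<zeta> + \<eta>) c K" and y: "norm (y - x) \<le> \<eta>"
  shows "y \<in> shrink \<zeta> c K"
proof -
  obtain k where k: "k \<in> K" "x = (1 - (\<zeta> + \<eta>)) *\<^sub>R k + (\<zeta> + \<eta>) *\<^sub>R c"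
    using x by (auto simp: shrink_def)
  \<comment> \<open>The displacement y - x, scaled up by 1 / \<eta>, stays in the unit ball about
    \<open>c\<close>. Replacing the share \<eta> of \<open>c\<close> in \<open>x\<close> by this
    point produces \<open>y\<close>.\<close>
  let ?q = "c + (1 / \<eta>) *\<^sub>R (y - x)"
  have q: "?q \<in> K" using K(2) y \<eta> by (auto simp: dist_norm divide_le_eq intro!: subsetD[OF K(2)])
  let ?s = "\<eta> / (1 - \<zeta>)"
  have s: "0 \<le> ?s" "?s \<le> 1" "(1 - \<zeta>) * ?s = \<eta>" using \<eta> by (auto simp: divide_le_eq)
  have "(1 - ?s) *\<^sub>R k + ?s *\<^sub>R ?q \<in> K" using K(1) k(1) q s by (intro convexD) auto
  moreover have "y = (1 - \<zeta>) *\<^sub>R ((1 - ?s) *\<^sub>R k + ?s *\<^sub>R ?q) + \<zeta> *\<^sub>R c"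
  proof -
    have "(1 - \<zeta>) * (1 - ?s) = 1 - (\<zeta> + \<eta>)" using s(3) by (simp only: right_diff_distrib) simp
    then have "(1 - \<zeta>) *\<^sub>R ((1 - ?s) *\<^sub>R k + ?s *\<^sub>R ?q) + \<zeta> *\<^sub>R c = (1 - (\<zeta> + \<eta>)) *\<^sub>R k + \<eta> *\<^sub>R ?q + \<zeta> *\<^sub>R c"
      by (simp only: scaleR_add_right[of "1 - \<zeta>"] scaleR_scaleR[of "1 - \<zeta>"] s(3))
    also have "\<eta> *\<^sub>R ?q = \<eta> *\<^sub>R c + (y - x)" using \<eta> by (simp add: scaleR_add_right)
    finally show ?thesis by (simp add: k(2) algebra_simps)
  qed
  ultimately show ?thesis by (auto simp: shrink_def)
qed

text \<open>A contraction only reduces distances, so a far point of the image comes from a far point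
  of \<open>K\<close>, while all volumes scale alike. The same R thus serves the smaller
  body.\<close>

lemma shrink_tail:
  fixes K :: "'a::euclidean_space set"
  assumes K: "compact K" and \<eta>: "0 \<le> \<eta>" "\<eta> < 1" and s: "0 \<le> s"
    and tail: "vol {x \<in> K. s \<le> norm (x - z)} \<le> vol K / 9"
  shows "vol {x \<in> shrink \<eta> c K. s \<le> norm (x - ((1 - \<eta>) *\<^sub>R z + \<eta> *\<^sub>R c))} \<le> vol (shrink \<eta> c K) / 9"
proof -
  let ?D = "{x \<in> K. s \<le> norm (x - z)}"
  let ?w = "(1 - \<eta>) *\<^sub>R z + \<eta> *\<^sub>R c"
  have cD: "compact ?D" using K by (rule compact_outside_ball)
  have cE: "compact {x \<in> shrink \<eta> c K. s \<le> norm (x - ?w)}"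
    by (intro compact_outside_ball compact_shrink K)
  have "{x \<in> shrink \<eta> c K. s \<le> norm (x - ?w)} \<subseteq> shrink \<eta> c ?D"
  proof
    fix x assume "x \<in> {x \<in> shrink \<eta> c K. s \<le> norm (x - ?w)}"
    then obtain k where k: "k \<in> K" "x = (1 - \<eta>) *\<^sub>R k + \<eta> *\<^sub>R c" and le: "s \<le> norm (x - ?w)" by (auto simp: shrink_def)
    have "x - ?w = (1 - \<eta>) *\<^sub>R (k - z)" by (simp add: k(2) algebra_simps)
    then have "norm (x - ?w) = (1 - \<eta>) * norm (k - z)" using \<eta> by simp
    also have "\<dots> \<le> norm (k - z)" using \<eta> by (intro mult_left_le_one_le) auto
    finally show "x \<in> shrink \<eta> c ?D" using k le by (auto simp: shrink_def)
  qed
  then have "vol {x \<in> shrink \<eta> c K. s \<le> norm (x - ?w)} \<le> vol (shrink \<eta> c ?D)"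
    using cE cD by (intro measure_mono_fmeasurable) (auto simp: lmeasurable_compact fmeasurableD compact_shrink)
  also have "\<dots> \<le> vol (shrink \<eta> c K) / 9"
    using tail \<eta> mult_left_mono[OF tail, of "(1 - \<eta>) ^ DIM('a)"] by (simp add: vol_shrink)
  finally show ?thesis .
qed

section \<open>Isoperimetry for axis-disjoint sets\<close>

lemma shrink_zero: "shrink 0 c K = K"
  by (simp add: shrink_def)

text \<open>The product-measure arguments use Borel sets. Approximation from inside is chosen
  because axis-disjointness passes to subsets.\<close>

lemma lebesgue_borel_subset:
  fixes S :: "'a::euclidean_space set"
  assumes "S \<in> sets lebesgue"
  obtains T where "T \<in> sets borel" "T \<subseteq> S" "negligible (S - T)" "vol T = vol S"
proof -
  obtain T N where T: "T \<in> sets borel" "negligible N" "T \<union> N = S"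
    using sets_lebesgue_almost_borel[OF assms] .
  have "vol S = vol T"
    unfolding T(3)[symmetric] using T(1,2) by (intro measure_Un_null_set) (auto simp: negligible_iff_null_sets)
  moreover have "negligible (S - T)" using T(2,3) by (auto intro: negligible_subset)
  ultimately show thesis using that T by auto
qed

text \<open>A number of agreements is nonnegative, which excludes dimension 1, and a common point
  would agree with itself in all coordinates.\<close>

lemma axis_disjoint_imp:
  fixes S T :: "(real ^ 'n) set"
  assumes "axis_disjoint S T" "S \<noteq> {}" "T \<noteq> {}"
  shows "2 \<le> CARD('n)" "S \<inter> T = {}"
proof -
  obtain x y where "x \<in> S" "y \<in> T" using assms by blast
  then have "0 \<le> int CARD('n) - 2" using assms(1) by (force simp: axis_disjoint_def)
  then show "2 \<le> CARD('n)" by simp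
  show "S \<inter> T = {}" using assms(1) by (force simp: axis_disjoint_def)
qed

lemma axis_disjoint_isoperimetry:
  fixes K T1 T2 :: "(real ^ 'n) set" and c z :: "real ^ 'n"
  defines "n \<equiv> real CARD('n)" and "\<sigma> \<equiv> vol (K - (T1 \<union> T2))"
  assumes K: "convex K" "compact K" "cball c 1 \<subseteq> K" "0 < vol K"
    and R: "1 / 2 \<le> R" and tail: "vol {x \<in> K. 3 * R \<le> norm (x - z)} \<le> vol K / 9"
    and T: "T1 \<in> sets borel" "T2 \<in> sets borel" "T1 \<subseteq> K" "T2 \<subseteq> K"
    and disj: "axis_disjoint T1 T2" "T1 \<inter> T2 = {}" and dim: "2 \<le> CARD('n)"
    and \<epsilon>: "0 < \<epsilon>" "\<epsilon> < 1" and w: "0 \<le> w" "w \<le> vol T1 - \<epsilon> * vol K" "w \<le> vol T2 - \<epsilon> * vol K"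
  shows "\<epsilon> / (800 * (n ^ 3 * sqrt n) * R) * w \<le> \<sigma>"
proof -
  have n: "2 \<le> n" using dim by (simp add: n_def)
  \<comment> \<open>Shrinking by 2 \<eta> loses at most the fraction 2 \<eta> n = \<epsilon> of the
    volume, by Bernoulli's inequality.\<close>
  define \<eta> where "\<eta> = \<epsilon> / (2 * n)"
  \<comment> \<open>A cube of half-side r reaches Euclidean distance sqrt n * r = \<eta>, exactly
    the margin gained by shrinking.\<close>
  define r where "r = \<eta> / sqrt n"
  have "\<epsilon> / (2 * n) \<le> \<epsilon> / (2 * 2)" using n \<epsilon> by (intro divide_left_mono) auto
  then have \<eta>: "0 < \<eta>" "\<eta> \<le> 1 / 4" using \<epsilon> n by (auto simp: \<eta>_def)
  have r: "0 < r" "sqrt n * r = \<eta>" using \<eta> n by (auto simp: r_def)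
  let ?L = "shrink \<eta> c K" and ?L' = "shrink (\<eta> + \<eta>) c K" and ?T3 = "K - (T1 \<union> T2)"
  have cL: "compact ?L" "compact ?L'" using K(2) by (auto intro: compact_shrink)
  have bK: "K \<in> sets borel" using K(2) by (rule borel_compact)
  have near: "norm (y - x) \<le> \<eta>" if "y \<in> cube r x" for x y :: "real ^ 'n"
    using norm_le_cube[OF that] r by (simp add: n_def)
  have cube_L: "cube r x \<subseteq> T1 \<union> T2 \<union> ?T3" if "x \<in> ?L" for x
  proof
    fix y assume "y \<in> cube r x"
    then have "y \<in> shrink 0 c K" using shrink_nbhd[OF K(1,3), of 0 \<eta> x y] that near \<eta> by simp
    then show "y \<in> T1 \<union> T2 \<union> ?T3" by (simp add: shrink_zero)
  qed
  have cube_L': "cube r x \<subseteq> ?L" if "x \<in> ?L'" for x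
    using shrink_nbhd[OF K(1,3), of \<eta> \<eta> x] that near \<eta> by auto
  have bdd: "bounded K" using K(2) by (rule compact_imp_bounded)
  obtain A B where AB: "compact A" "compact B" "A \<subseteq> ?L" "B \<subseteq> ?L"
    and dist: "\<And>x y. x \<in> A \<Longrightarrow> y \<in> B \<Longrightarrow> 2 * r / (3 * n) < norm (x - y)"
    and part: "measure lborel (T1 \<inter> ?L') \<le> measure lborel A + 4 * n * measure lborel ?T3"
      "measure lborel (T2 \<inter> ?L') \<le> measure lborel B + 4 * n * measure lborel ?T3"
      "measure lborel (?L - (A \<union> B)) \<le> 16 / 3 * n * measure lborel ?T3"
    unfolding n_def
    by (rule axis_disjoint_partition[of r ?L ?L' T1 T2 ?T3])
      (use r cL T bK disj cube_L cube_L' bounded_subset[OF bdd] in \<open>auto intro: borel_compact\<close>)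
  have \<sigma>: "measure lborel ?T3 = \<sigma>" using bK T by (simp add: \<sigma>_def vol_borel)
  have bAB: "A \<in> sets borel" "B \<in> sets borel" "?L \<in> sets borel" "?L' \<in> sets borel"
    using AB cL by (auto intro: borel_compact)
  have L'K: "(1 - \<epsilon>) * vol K \<le> vol ?L'"
  proof -
    have "1 - \<epsilon> = 1 + real CARD('n) * (- (\<eta> + \<eta>))" using n by (simp add: \<eta>_def n_def)
    also have "\<dots> \<le> (1 + - (\<eta> + \<eta>)) ^ CARD('n)" using \<eta> by (intro Bernoulli_inequality) simp
    finally show ?thesis using \<eta> by (simp add: vol_shrink mult_right_mono)
  qed
  have keep: "vol T - \<epsilon> * vol K \<le> measure lborel (T \<inter> ?L')" if T: "T \<in> sets borel" "T \<subseteq> K" for T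
  proof -
    have fm: "K \<in> lmeasurable" "?L' \<in> lmeasurable" using K(2) cL by (auto intro: lmeasurable_compact)
    have sub: "?L' \<subseteq> K"
      using shrink_nbhd[OF K(1,3), of 0 "\<eta> + \<eta>"] \<eta> by (force simp: shrink_zero)
    have "vol T \<le> vol ((T \<inter> ?L') \<union> (K - ?L'))"
    proof (rule measure_mono_fmeasurable)
      have mT: "T \<in> lmeasurable"
        using T bounded_subset[OF bdd T(2)] by (intro bounded_set_imp_lmeasurable) auto
      then show "T \<in> sets lebesgue" by (rule fmeasurableD)
      show "(T \<inter> ?L') \<union> (K - ?L') \<in> lmeasurable"
        by (intro fmeasurable.Un fmeasurable.Int fmeasurable.Diff mT fm)
    qed (use T in auto)
    also have "\<dots> \<le> vol (T \<inter> ?L') + vol (K - ?L')"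
      using T fm bAB by (intro measure_Un_le) auto
    also have "vol (K - ?L') = vol K - vol ?L'"
      by (rule measurable_measure_Diff[OF fm(1) fmeasurableD[OF fm(2)] sub])
    finally show ?thesis using L'K T bAB by (simp add: vol_borel algebra_simps)
  qed
  define d where "d = 2 * r / (3 * n)"
  have d_eq: "d = \<epsilon> / (3 * n\<^sup>2 * sqrt n)" using n by (simp add: d_def r_def \<eta>_def power2_eq_square)
  have d0: "0 < d" using r n by (simp add: d_def)
  \<comment> \<open>Together with R \<ge> 1/2 this yields d \<le> R, and it makes k at most 1/150
    below.\<close>
  have "d \<le> 1 / 12"
  proof -
    have "1 \<le> sqrt n" using n by simp
    then have "\<eta> / sqrt n \<le> (1 / 4) / 1" using \<eta> by (intro frac_le) auto
    then have "r \<le> 1 / 4" by (simp add: r_def)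
    then have "2 * r / (3 * n) \<le> (1 / 2) / (3 * 2)" using r n by (intro frac_le) auto
    then show ?thesis by (simp add: d_def)
  qed
  have vL: "0 < vol ?L" using K(4) \<eta> by (simp add: vol_shrink)
  have tail_L: "vol {x \<in> ?L. 3 * R \<le> norm (x - ((1 - \<eta>) *\<^sub>R z + \<eta> *\<^sub>R c))} \<le> vol ?L / 9"
    using \<eta> R tail by (intro shrink_tail K) auto
  have "d / (25 * R) * min (vol A) (vol B) \<le> vol (?L - (A \<union> B))"
    using isoperimetric[OF convex_shrink[OF K(1)] cL(1) vL tail_L AB(1,3,2,4) d0] dist R \<open>d \<le> 1 / 12\<close>
    by (simp add: d_def)
  also have "\<dots> \<le> 16 / 3 * n * \<sigma>" using part(3) bAB by (simp add: vol_borel \<sigma>)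
  finally have main: "d / (25 * R) * min (vol A) (vol B) \<le> 16 / 3 * n * \<sigma>" .
  have "w - 4 * n * \<sigma> \<le> vol A" "w - 4 * n * \<sigma> \<le> vol B"
    using part(1,2) keep[OF T(1,3)] keep[OF T(2,4)] w bAB by (simp_all add: vol_borel \<sigma>)
  then have wmin: "w - 4 * n * \<sigma> \<le> min (vol A) (vol B)" by simp
  define k where "k = d / (25 * R)"
  have k: "0 < k" "k \<le> 1 / 150"
  proof -
    have "d / (25 * R) \<le> (1 / 12) / (25 * (1 / 2))" using d0 R \<open>d \<le> 1 / 12\<close> by (intro frac_le) auto
    then show "0 < k" "k \<le> 1 / 150" using d0 R by (auto simp: k_def)
  qed
  have "0 \<le> n * \<sigma>" using n by (simp add: \<sigma>_def)
  have "k * (w - 4 * n * \<sigma>) \<le> 16 / 3 * n * \<sigma>"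
    using mult_left_mono[OF wmin, of k] k main by (simp add: k_def)
  moreover have "k * (n * \<sigma>) \<le> 1 / 150 * (n * \<sigma>)" using k \<open>0 \<le> n * \<sigma>\<close> by (intro mult_right_mono) auto
  \<comment> \<open>The true factor is 16/3 + 4/150. Any value up to 32/3 would do, because k w is
    32/3 n times the claimed bound.\<close>
  ultimately have "k * w \<le> 10 * (n * \<sigma>)" using \<open>0 \<le> n * \<sigma>\<close> by (simp add: algebra_simps)
  moreover have "k * w = 32 / 3 * n * (\<epsilon> / (800 * (n ^ 3 * sqrt n) * R) * w)"
    using n R by (simp add: k_def d_eq field_simps power2_eq_square power3_eq_cube)
  moreover have "0 \<le> \<epsilon> / (800 * (n ^ 3 * sqrt n) * R) * w" using n R \<epsilon> w by simp
  ultimately have "n * (\<epsilon> / (800 * (n ^ 3 * sqrt n) * R) * w) \<le> n * \<sigma>" using \<open>0 \<le> n * \<sigma>\<close> by linarith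
  moreover have "0 < n" using n by simp
  ultimately show ?thesis by (simp only: mult_le_cancel_left_pos)
qed

theorem theorem2:
  fixes K S1 S2 :: "(real ^ 'n) set" and R \<epsilon> :: real
  assumes "convex_body K"
    and "\<exists>c. cball c 1 \<subseteq> K"
    and "R \<ge> 0"
    and "R\<^sup>2 = uniform_expectation K (\<lambda>x. (norm (x - centroid K))\<^sup>2)"
    and "S1 \<in> sets lebesgue" and "S2 \<in> sets lebesgue"
    and "S1 \<subseteq> K" and "S2 \<subseteq> K"
    and "axis_disjoint S1 S2"
    and "\<epsilon> \<ge> 0"
  shows "vol (K - (S1 \<union> S2)) \<ge>
    \<epsilon> / (800 * real CARD('n) powr 3.5 * R) * (min (vol S1) (vol S2) - \<epsilon> * vol K)"
proof -
  let ?w = "min (vol S1) (vol S2) - \<epsilon> * vol K"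
  show ?thesis
  proof (cases "0 < \<epsilon> \<and> 0 < ?w")
    \<comment> \<open>The right side is then at most 0. This includes R = 0, where division by zero
      makes the coefficient 0.\<close>
    case False
    let ?q = "\<epsilon> / (800 * real CARD('n) powr 3.5 * R)"
    have "0 \<le> ?q" using assms(3,10) by simp
    moreover have "?q = 0 \<or> ?w \<le> 0"
    proof (cases "\<epsilon> = 0")
      case \<epsilon>: False
      then have "\<not> 0 < ?w" using False assms(10) by (metis order_le_less)
      then show ?thesis by (simp only: not_less simp_thms)
    qed simp
    ultimately have "?q * ?w \<le> 0" by (auto simp only: mult_zero_left order_refl intro: mult_nonneg_nonpos)
    then show ?thesis by (meson measure_nonneg order_trans)
  next
    case True
    have K: "convex K" "compact K" using assms(1) by (auto simp: convex_body_def)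
    have Km: "K \<in> lmeasurable" using K(2) by (rule lmeasurable_compact)
    obtain c where c: "cball c 1 \<subseteq> K" using assms(2) by blast
    have pos: "\<epsilon> * vol K < vol S1" "\<epsilon> * vol K < vol S2" using True by auto
    moreover have "0 \<le> \<epsilon> * vol K" using assms(10) by simp
    ultimately have "0 < vol S1" "0 < vol S2" by linarith+
    then have ne: "S1 \<noteq> {}" "S2 \<noteq> {}" by auto
    \<comment> \<open>Both sets have positive volume here, so the dimension is at least 2; this is
      what the lower bound on R relies on.\<close>
    note dim = axis_disjoint_imp[OF assms(9) ne]
    have S1K: "vol S1 \<le> vol K" using assms(5,7) Km by (intro measure_mono_fmeasurable) auto
    then have V: "0 < vol K" using \<open>0 < vol S1\<close> by linarith
    have "\<epsilon> * vol K < 1 * vol K" using S1K pos by linarith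
    then have "\<epsilon> < 1" using V by (simp only: mult_less_cancel_right_pos)
    have "1 / 4 \<le> R\<^sup>2" unfolding assms(4) using dim(1) by (intro second_moment_ge[OF K(2) c]) simp
    then have "(1 / 2)\<^sup>2 \<le> R\<^sup>2" by (simp add: power2_eq_square)
    then have R: "1 / 2 \<le> R" using assms(3) by (rule power2_le_imp_le)
    \<comment> \<open>Radius 3 R in Markov's inequality gives the fraction R^2 / (3 R)^2 =
      1/9.\<close>
    have tail: "vol {x \<in> K. 3 * R \<le> norm (x - centroid K)} \<le> vol K / 9"
      using second_moment_tail[OF K(2) V, of "3 * R" "centroid K"] R
      by (simp add: assms(4)[symmetric] power_mult_distrib)
    obtain T1 where T1: "T1 \<in> sets borel" "T1 \<subseteq> S1" "negligible (S1 - T1)" "vol T1 = vol S1"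
      using lebesgue_borel_subset[OF assms(5)] .
    obtain T2 where T2: "T2 \<in> sets borel" "T2 \<subseteq> S2" "negligible (S2 - T2)" "vol T2 = vol S2"
      using lebesgue_borel_subset[OF assms(6)] .
    have "vol (K - (T1 \<union> T2)) = vol (K - (S1 \<union> S2))"
    proof -
      \<comment> \<open>Disjointness of \<open>S1\<close> and \<open>S2\<close> matters: a point
        lost from one set must not lie in the Borel part of the other.\<close>
      have "K - (T1 \<union> T2) = (K - (S1 \<union> S2)) \<union> (K \<inter> ((S1 - T1) \<union> (S2 - T2)))"
        using T1(2) T2(2) assms(7,8) dim(2) by auto
      moreover have "negligible (K \<inter> ((S1 - T1) \<union> (S2 - T2)))"
        using T1(3) T2(3) by (intro negligible_Int) (auto intro: negligible_Un)
      ultimately show ?thesis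
        using Km assms(5,6) by (simp add: measure_Un_null_set negligible_iff_null_sets fmeasurableD)
    qed
    moreover have "\<epsilon> / (800 * (real CARD('n) ^ 3 * sqrt (real CARD('n))) * R) * ?w \<le> vol (K - (T1 \<union> T2))"
    proof (rule axis_disjoint_isoperimetry[OF K c V R tail])
      show "axis_disjoint T1 T2" using assms(9) T1(2) T2(2) by (auto simp: axis_disjoint_def subset_iff)
    qed (use T1 T2 assms(7,8) dim True \<open>\<epsilon> < 1\<close> in auto)
    moreover have "real CARD('n) powr 3.5 = real CARD('n) ^ 3 * sqrt (real CARD('n))"
    proof -
      have "real CARD('n) powr 3.5 = real CARD('n) powr (3 + 1 / 2)" by simp
      also have "\<dots> = real CARD('n) powr 3 * real CARD('n) powr (1 / 2)" by (rule powr_add)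
      finally show ?thesis by (simp add: powr_half_sqrt powr_numeral)
    qed
    ultimately show ?thesis by simp
  qed
qed

end
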